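(* Consider the convex problem (P), its dual (D), and the accelerated augmented Lagrangian method (AALM) described in the context. Suppose $\sup(D)>-\infty$, and let the AALM be executed, generating $\{x^k\}$ and $\{y^k\}\subset\mathbb{R}^m_+$. (a) If the generated sequence $\{y^k\}$ is bounded, then $y^k\to y^\infty$, where $y^\infty$ is some optimal solution to (D), and $\{x^k\}$ is asymptotically minimizing for (P), with $$f_i(x^{k+1})\le\frac{1}{c_k}\left\{y^{k+1}_i-y^k_i+\frac{1}{k+1}\big[y^{k+1}_i-y^0_i\big]\right\}\to 0,\quad i=1,\ldots,m,$$ $$f_0(x^{k+1})-\operatorname{asym}\inf(P)\le\frac{1}{2c_k}\left[\varepsilon_k^2+\|y^k\|^2-\|y^{k+1}\|^2-\frac{2k+3}{(k+1)^2}\left\langle y^{k+1}-y^0,\,y^{k+1}-\frac{1}{2k+3}y^0\right\rangle\right].$$ (b) The boundedness of $\{y^k\}$ under criterion (C) is actually equivalent to the existence of an optimal solution to (D). It holds if (P) satisfies the Slater condition; in this case one has $\max(D)=\inf(P)=\operatorname{asym}\inf(P)$. (c) If $\{y^k\}$ is bounded and there exists an $\alpha_0$ such that the set $$\{x\in\mathbb{R}^n: x\text{ is feasible for }(P)\text{ and }f_0(x)\le\alpha_0\}$$ is nonempty and bounded, then the sequence $\{x^k\}$ is also bounded, and all of its cluster points are optimal solutions to (P).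
   Context: Problem (P): minimize $f_0(x)$ over $x\in C$ subject to $f_j(x)\le 0$, $j=1,\ldots,m$, where $C\subseteq\mathbb{R}^n$ is a nonempty closed convex set and $f_i:\mathbb{R}^n\to\mathbb{R}$ is a lower semicontinuous convex function, $i=0,1,\ldots,m$. Write $F(x)=(f_1(x),\ldots,f_m(x))$. A point $x$ is feasible for (P) if $x\in C$ and $f_j(x)\le0$ for all $j=1,\ldots,m$. Slater condition: there is $x\in C$ with $f_j(x)<0$ for $j=1,\ldots,m$. Problem (D): maximize $g_0(y)=\inf_{x\in C}\{f_0(x)+\sum_{j=1}^m y_jf_j(x)\}$ subject to $y\ge 0$, $y\in\mathbb{R}^m$. $\sup(D)$ (or $\max(D)$ when attained) and $\inf(P)$ denote the optimal values. For $c>0$, $y\in\mathbb{R}^m$, let $Y(x,y,c)=\Pi_{\mathbb{R}^m_+}[y+cF(x)]$ ($\Pi_{\mathbb{R}^m_+}$ the Euclidean projection onto the nonnegative orthant), and define the augmented Lagrangian $L(x,y,c)=f_0(x)+\frac{1}{2c}\big[\|\Pi_{\mathbb{R}^m_+}[y+cF(x)]\|^2-\|y\|^2\big]$ for $x\in C$ and $L(x,y,c)=+\infty$ for $x\notin C$. AALM: choose $y^0\in\mathbb{R}^m_+$ and a sequence of parameters $\{c_k\}$, $c_k>0$. For $k=0,1,2,\ldots$, with $\phi_k(x)=L(x,y^k,c_k)$: compute $x^{k+1}\approx\arg\min\phi_k$ according to criterion (C); set $\bar y^k=Y(x^{k+1},y^k,c_k)$ and $y^{k+1}=\frac{1}{k+2}y^0+\frac{k+1}{k+2}\bar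 y^k$. Criterion (C): $\phi_k(x^{k+1})-\inf\phi_k\le\varepsilon_k^2/(2c_k)$ for all $k$, where $\varepsilon_k\ge0$ and $\sum_{k=0}^\infty\varepsilon_k<+\infty$. A sequence $\{x^k\}\subseteq C$ is asymptotically minimizing for (P) if $\limsup_{k}f_i(x^k)\le 0$ for $i=1,\ldots,m$, and $\limsup_k f_0(x^k)$ attains the smallest possible value among all sequences in $C$ with this property; this smallest value is the asymptotic infimum $\operatorname{asym}\inf(P)$.
   Formalization: The parameters c_k are assumed bounded away from zero (some δ>0 with c_k≥δ for all k), not only c_k>0; without this the claim fails, e.g. f_0=x², f_1=2−2x, C=ℝ, y⁰=0, c_k=2^{-k}, ε_k=0 gives y^k→0 while the only dual solution is 1. *)

theory Defs
  imports "HOL-Analysis.Analysis"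
begin

text \<open>
  The problem (P) is given by a set \<open>C\<close>, an objective \<open>f0\<close> and a family \<open>f\<close> of constraint
  functions; the index type \<open>'m\<close> stands for \<open>{1,\<dots>,m}\<close>. Optimal values are extended reals.
\<close>

definition lower_semicontinuous :: "('a::topological_space \<Rightarrow> real) \<Rightarrow> bool" where
  "lower_semicontinuous h \<longleftrightarrow> (\<forall>x. \<forall>a < h x. \<forall>\<^sub>F z in nhds x. a < h z)"

definition convex_program ::
  "(real^'n) set \<Rightarrow> (real^'n \<Rightarrow> real) \<Rightarrow> ('m::finite \<Rightarrow> real^'n \<Rightarrow> real) \<Rightarrow> bool" where
  "convex_program C f0 f \<longleftrightarrow>
     C \<noteq> {} \<and> closed C \<and> convex C \<and>
     convex_on UNIV f0 \<and> lower_semicontinuous f0 \<and>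
     (\<forall>j. convex_on UNIV (f j) \<and> lower_semicontinuous (f j))"

definition feasible :: "(real^'n) set \<Rightarrow> ('m::finite \<Rightarrow> real^'n \<Rightarrow> real) \<Rightarrow> (real^'n) set" where
  "feasible C f = {x \<in> C. \<forall>j. f j x \<le> 0}"

definition slater :: "(real^'n) set \<Rightarrow> ('m::finite \<Rightarrow> real^'n \<Rightarrow> real) \<Rightarrow> bool" where
  "slater C f \<longleftrightarrow> (\<exists>x\<in>C. \<forall>j. f j x < 0)"

definition primal_value ::
  "(real^'n) set \<Rightarrow> (real^'n \<Rightarrow> real) \<Rightarrow> ('m::finite \<Rightarrow> real^'n \<Rightarrow> real) \<Rightarrow> ereal" where
  "primal_value C f0 f = (INF x\<in>feasible C f. ereal (f0 x))"

definition primal_optimal ::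
  "(real^'n) set \<Rightarrow> (real^'n \<Rightarrow> real) \<Rightarrow> ('m::finite \<Rightarrow> real^'n \<Rightarrow> real) \<Rightarrow> real^'n \<Rightarrow> bool" where
  "primal_optimal C f0 f x \<longleftrightarrow> x \<in> feasible C f \<and> (\<forall>z\<in>feasible C f. f0 x \<le> f0 z)"

definition nonneg_orthant :: "(real^'m) set" where
  "nonneg_orthant = {y. \<forall>i. 0 \<le> y $ i}"

definition dual_fun ::
  "(real^'n) set \<Rightarrow> (real^'n \<Rightarrow> real) \<Rightarrow> ('m::finite \<Rightarrow> real^'n \<Rightarrow> real) \<Rightarrow> real^'m \<Rightarrow> ereal" where
  "dual_fun C f0 f y = (INF x\<in>C. ereal (f0 x + (\<Sum>j\<in>UNIV. y $ j * f j x)))"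

definition dual_value ::
  "(real^'n) set \<Rightarrow> (real^'n \<Rightarrow> real) \<Rightarrow> ('m::finite \<Rightarrow> real^'n \<Rightarrow> real) \<Rightarrow> ereal" where
  "dual_value C f0 f = (SUP y\<in>nonneg_orthant. dual_fun C f0 f y)"

definition dual_optimal ::
  "(real^'n) set \<Rightarrow> (real^'n \<Rightarrow> real) \<Rightarrow> ('m::finite \<Rightarrow> real^'n \<Rightarrow> real) \<Rightarrow> real^'m \<Rightarrow> bool" where
  "dual_optimal C f0 f y \<longleftrightarrow>
     y \<in> nonneg_orthant \<and> (\<forall>z\<in>nonneg_orthant. dual_fun C f0 f z \<le> dual_fun C f0 f y)"

definition asym_feasible ::
  "(real^'n) set \<Rightarrow> ('m::finite \<Rightarrow> real^'n \<Rightarrow> real) \<Rightarrow> (nat \<Rightarrow> real^'n) \<Rightarrow> bool" where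
  "asym_feasible C f x \<longleftrightarrow>
     (\<forall>k. x k \<in> C) \<and> (\<forall>i. limsup (\<lambda>k. ereal (f i (x k))) \<le> 0)"

definition asym_inf ::
  "(real^'n) set \<Rightarrow> (real^'n \<Rightarrow> real) \<Rightarrow> ('m::finite \<Rightarrow> real^'n \<Rightarrow> real) \<Rightarrow> ereal" where
  "asym_inf C f0 f = (INF x\<in>{x. asym_feasible C f x}. limsup (\<lambda>k. ereal (f0 (x k))))"

definition asym_minimizing ::
  "(real^'n) set \<Rightarrow> (real^'n \<Rightarrow> real) \<Rightarrow> ('m::finite \<Rightarrow> real^'n \<Rightarrow> real) \<Rightarrow> (nat \<Rightarrow> real^'n) \<Rightarrow> bool"
  where
  "asym_minimizing C f0 f x \<longleftrightarrow>
     asym_feasible C f x \<and> limsup (\<lambda>k. ereal (f0 (x k))) = asym_inf C f0 f"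

definition constr :: "('m::finite \<Rightarrow> real^'n \<Rightarrow> real) \<Rightarrow> real^'n \<Rightarrow> real^'m" where
  "constr f x = (\<chi> j. f j x)"

definition multiplier_update ::
  "('m::finite \<Rightarrow> real^'n \<Rightarrow> real) \<Rightarrow> real^'n \<Rightarrow> real^'m \<Rightarrow> real \<Rightarrow> real^'m" where
  "multiplier_update f x y c = closest_point nonneg_orthant (y + c *\<^sub>R constr f x)"

definition aug_lagrangian ::
  "(real^'n) set \<Rightarrow> (real^'n \<Rightarrow> real) \<Rightarrow> ('m::finite \<Rightarrow> real^'n \<Rightarrow> real) \<Rightarrow>
     real^'n \<Rightarrow> real^'m \<Rightarrow> real \<Rightarrow> ereal" where
  "aug_lagrangian C f0 f x y c =
     (if x \<in> C
      then ereal (f0 x + 1 / (2 * c) *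
             ((norm (closest_point nonneg_orthant (y + c *\<^sub>R constr f x)))\<^sup>2 - (norm y)\<^sup>2))
      else \<infinity>)"

text \<open>
  The method computes \<open>x (k + 1)\<close> for \<open>k \<ge> 0\<close>; the value \<open>x 0\<close> is unconstrained.
  If the infimum in the criterion is \<open>-\<infinity>\<close>, the difference is \<open>\<infinity>\<close>, so the criterion fails.
\<close>

definition criterion_C ::
  "(real^'n) set \<Rightarrow> (real^'n \<Rightarrow> real) \<Rightarrow> ('m::finite \<Rightarrow> real^'n \<Rightarrow> real) \<Rightarrow>
     (nat \<Rightarrow> real) \<Rightarrow> (nat \<Rightarrow> real) \<Rightarrow> (nat \<Rightarrow> real^'n) \<Rightarrow> (nat \<Rightarrow> real^'m) \<Rightarrow> bool" where
  "criterion_C C f0 f c \<epsilon> x y \<longleftrightarrow>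
     (\<forall>k. 0 \<le> \<epsilon> k) \<and> summable \<epsilon> \<and>
     (\<forall>k. aug_lagrangian C f0 f (x (Suc k)) (y k) (c k)
            - (INF z. aug_lagrangian C f0 f z (y k) (c k))
          \<le> ereal ((\<epsilon> k)\<^sup>2 / (2 * c k)))"

definition AALM ::
  "(real^'n) set \<Rightarrow> (real^'n \<Rightarrow> real) \<Rightarrow> ('m::finite \<Rightarrow> real^'n \<Rightarrow> real) \<Rightarrow>
     (nat \<Rightarrow> real) \<Rightarrow> (nat \<Rightarrow> real) \<Rightarrow> (nat \<Rightarrow> real^'n) \<Rightarrow> (nat \<Rightarrow> real^'m) \<Rightarrow> bool" where
  "AALM C f0 f c \<epsilon> x y \<longleftrightarrow>
     y 0 \<in> nonneg_orthant \<and> (\<forall>k. 0 < c k) \<and>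
     criterion_C C f0 f c \<epsilon> x y \<and>
     (\<forall>k. y (Suc k) =
        (1 / (real k + 2)) *\<^sub>R y 0 +
        ((real k + 1) / (real k + 2)) *\<^sub>R multiplier_update f (x (Suc k)) (y k) (c k))"

end

(*
  The proximal points J_k of the concave dual function at y_k are limits of multiplier updates along
  minimizing sequences of the augmented Lagrangian, and the multiplier computed under criterion (C)
  is within eps_k of J_k. Hence (y_k) is an inexact Halpern iteration for the proximal point
  algorithm on the dual, and it converges to the dual solution nearest to y_0. The estimates for x_k are read off
  the formula for the multiplier update and off weak duality with the asymptotic infimum.
*)
theory Submission
  imports Defs
begin

section \<open>Proximal points of the dual and the augmented Lagrangian\<close>

text \<open>The augmented Lagrangian need not attain its infimum, and minimizing sequences in
  \<open>C\<close> may run off to infinity, so no minimizer is at hand whose multiplier would be the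
  proximal point. What survives is the multiplier: the Lagrangian penalized by |z - y|^2/(2c) is
  strongly concave in \<open>z\<close>, which bounds the multipliers along any minimizing sequence.
  The same strong concavity turns the gap eps_k^2/(2 c_k) of criterion (C) into the distance eps_k.

  The vector (J_k - y_k)/c_k is a supergradient of the dual on the orthant at J_k. Compared with a
  dual solution it gives the inequality on which the Halpern argument runs; when it tends to zero,
  cluster points of J_k are optimal, and there the lower bound on \<open>c\<close> enters.

  Without the Slater condition inf(P) may exceed sup(D) and (P) may have no solution. The asymptotic
  infimum is the primal value that closes this gap: weak duality bounds it below by sup(D), and the
  iterates themselves, being asymptotically feasible, bound it above.\<close>

lemma closed_nonneg_orthant: "closed (nonneg_orthant :: (real^'m) set)"
proof -
  have eq: "nonneg_orthant = (\<Inter>i. {y :: real^'m. 0 \<le> y $ i})"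
    by (auto simp: nonneg_orthant_def)
  show ?thesis
    unfolding eq by (intro closed_INT ballI closed_Collect_le continuous_intros)
qed

lemma convex_nonneg_orthant: "convex (nonneg_orthant :: (real^'m) set)"
  by (auto simp: convex_def nonneg_orthant_def)

lemma closest_point_nonneg_orthant:
  "closest_point nonneg_orthant (v :: real^'m) = (\<chi> i. max 0 (v $ i))"
proof -
  let ?p = "\<chi> i. max 0 (v $ i)"
  have "?p \<in> nonneg_orthant" by (simp add: nonneg_orthant_def)
  moreover have "dist v ?p \<le> dist v z" if z: "z \<in> nonneg_orthant" for z
    unfolding dist_vec_def
  proof (rule L2_set_mono)
    fix i
    have "0 \<le> z $ i" using z by (simp add: nonneg_orthant_def)
    then show "dist (v $ i) (?p $ i) \<le> dist (v $ i) (z $ i)" by (simp add: dist_real_def)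
  qed simp
  ultimately show ?thesis
    using closest_point_unique[OF convex_nonneg_orthant closed_nonneg_orthant, of ?p v] by auto
qed

lemma multiplier_update_nth:
  "multiplier_update f x y c $ i = max 0 (y $ i + c * f i x)"
  by (simp add: multiplier_update_def closest_point_nonneg_orthant constr_def)

lemma multiplier_update_nonneg: "multiplier_update f x y c \<in> nonneg_orthant"
  by (simp add: nonneg_orthant_def multiplier_update_nth)

lemma dual_fun_eq: "dual_fun C f0 f y = (INF x\<in>C. ereal (f0 x + y \<bullet> constr f x))"
  by (simp add: dual_fun_def constr_def inner_vec_def)

lemma dual_fun_le: "x \<in> C \<Longrightarrow> dual_fun C f0 f y \<le> ereal (f0 x + y \<bullet> constr f x)"
  unfolding dual_fun_eq by (rule INF_lower)

lemma dual_fun_ge: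
  "(\<And>x. x \<in> C \<Longrightarrow> a \<le> f0 x + y \<bullet> constr f x) \<Longrightarrow> ereal a \<le> dual_fun C f0 f y"
  unfolding dual_fun_eq by (rule INF_greatest) simp

lemma aug_lagrangian_eq:
  "x \<in> C \<Longrightarrow> aug_lagrangian C f0 f x y c =
    ereal (f0 x + ((norm (multiplier_update f x y c))\<^sup>2 - (norm y)\<^sup>2) / (2 * c))"
  by (simp add: aug_lagrangian_def multiplier_update_def)

text \<open>For fixed \<open>x\<close> the augmented Lagrangian is the maximum over nonnegative
  \<open>z\<close> of the Lagrangian minus |z - y|^2/(2c), and the multiplier update is the
  maximizer. The curvature 1/c of this concave quadratic produces the surplus |z - V|^2/(2c), on
  which the later distance estimates for multipliers rest.\<close>

lemma lagrangian_le_aug_lagrangian: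
  assumes "c > 0" "z \<in> nonneg_orthant"
  shows "f0 x + z \<bullet> constr f x - (norm (z - y))\<^sup>2 / (2 * c)
    \<le> f0 x + ((norm (multiplier_update f x y c))\<^sup>2 - (norm y)\<^sup>2) / (2 * c)
        - (norm (z - multiplier_update f x y c))\<^sup>2 / (2 * c)"
proof -
  let ?V = "multiplier_update f x y c"
  have "z \<bullet> (y + c *\<^sub>R constr f x) \<le> z \<bullet> ?V"
    unfolding inner_vec_def using assms
    by (intro sum_mono) (auto simp: multiplier_update_nth constr_def nonneg_orthant_def
        intro!: mult_left_mono)
  then have "2 * c * (z \<bullet> constr f x) - (norm (z - y))\<^sup>2
      \<le> (norm ?V)\<^sup>2 - (norm y)\<^sup>2 - (norm (z - ?V))\<^sup>2"
    by (simp add: power2_norm_eq_inner inner_diff_left inner_diff_right inner_add_right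
        inner_commute algebra_simps)
  then have "(2 * c * (z \<bullet> constr f x) - (norm (z - y))\<^sup>2) / (2 * c)
      \<le> ((norm ?V)\<^sup>2 - (norm y)\<^sup>2 - (norm (z - ?V))\<^sup>2) / (2 * c)"
    using \<open>c > 0\<close> by (intro divide_right_mono) auto
  then show ?thesis
    using \<open>c > 0\<close> by (simp add: diff_divide_distrib)
qed

text \<open>
  The constraint values at \<open>x'\<close> are raised to \<open>(V - y) / c\<close>, which leaves the augmented
  Lagrangian unchanged; this is why \<open>d\<close> stays bounded even if \<open>constr f x'\<close> does not.
\<close>

lemma aug_lagrangian_segment:
  fixes x x' :: "real^'n" and f :: "'m::finite \<Rightarrow> real^'n \<Rightarrow> real" and y :: "real^'m"
  assumes P: "convex_program C f0 f" and c: "c > 0" and t: "0 \<le> t" "t \<le> 1"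
  defines "V \<equiv> multiplier_update f x' y c"
  defines "d \<equiv> y + c *\<^sub>R constr f x - V"
  defines "w \<equiv> (1 - t) *\<^sub>R x' + t *\<^sub>R x"
  shows "f0 w + ((norm (multiplier_update f w y c))\<^sup>2 - (norm y)\<^sup>2) / (2 * c)
    \<le> (1 - t) * f0 x' + t * f0 x + ((norm (V + t *\<^sub>R d))\<^sup>2 - (norm y)\<^sup>2) / (2 * c)"
proof -
  have cf: "convex_on UNIV f0" "\<And>j. convex_on UNIV (f j)"
    using P by (auto simp: convex_program_def)
  have f0w: "f0 w \<le> (1 - t) * f0 x' + t * f0 x"
    using convex_onD[OF cf(1) t] by (simp add: w_def)
  \<comment> \<open>Entries of \<open>V + t d\<close> may be negative. The entries on the left are
    positive parts, so an upper bound before taking the positive part already compares the absolute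
    values.\<close>
  have "norm (multiplier_update f w y c) \<le> norm (V + t *\<^sub>R d)"
  proof (rule norm_le_componentwise_cart)
    fix i
    have "f i w \<le> (1 - t) * f i x' + t * f i x"
      using convex_onD[OF cf(2) t] by (simp add: w_def)
    then have "y $ i + c * f i w \<le> y $ i + c * ((1 - t) * f i x' + t * f i x)"
      using c by simp
    also have "\<dots> = (1 - t) * (y $ i + c * f i x') + t * (y $ i + c * f i x)"
      by (simp add: algebra_simps)
    also have "\<dots> \<le> (1 - t) * V $ i + t * (y $ i + c * f i x)"
      using t by (auto simp: V_def multiplier_update_nth intro!: mult_left_mono)
    also have "\<dots> = (V + t *\<^sub>R d) $ i"
      by (simp add: d_def constr_def algebra_simps)
    finally show "norm (multiplier_update f w y c $ i) \<le> norm ((V + t *\<^sub>R d) $ i)"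
      by (auto simp: multiplier_update_nth)
  qed
  then have "(norm (multiplier_update f w y c))\<^sup>2 \<le> (norm (V + t *\<^sub>R d))\<^sup>2"
    by (rule power_mono) simp
  then show ?thesis
    using f0w c by (intro add_mono divide_right_mono) auto
qed

text \<open>A Lagrangian bounded below for one multiplier suffices to bound the augmented Lagrangian
  below for every \<open>y\<close>, and serves as the reference level for superlevel sets of the
  dual.\<close>

lemma dual_finite_point:
  assumes "dual_value C f0 f > - \<infinity>"
  obtains z a where "z \<in> nonneg_orthant" "\<And>x. x \<in> C \<Longrightarrow> a \<le> f0 x + z \<bullet> constr f x"
proof -
  obtain z where z: "z \<in> nonneg_orthant" "- \<infinity> < dual_fun C f0 f z"
    using assms by (auto simp: dual_value_def less_SUP_iff)
  obtain a where a: "ereal a < dual_fun C f0 f z"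
    using ereal_dense2[OF z(2)] by auto
  show thesis
  proof (rule that[OF z(1)])
    fix x assume "x \<in> C"
    then show "a \<le> f0 x + z \<bullet> constr f x"
      using less_le_trans[OF a dual_fun_le] by (simp add: less_imp_le)
  qed
qed

text \<open>
  The point \<open>J\<close> is the proximal point \<open>argmax z. dual_fun C f0 f z - |z - y|\<^sup>2 / (2 c)\<close>; it arises as a
  limit of multiplier updates along a minimizing sequence of the augmented Lagrangian.
\<close>

proposition aug_lagrangian_prox:
  fixes C :: "(real^'n) set" and f :: "'m::finite \<Rightarrow> real^'n \<Rightarrow> real"
  assumes P: "convex_program C f0 f" and D: "dual_value C f0 f > - \<infinity>" and c: "c > 0"
  obtains J I where
    "J \<in> nonneg_orthant"
    "(INF z. aug_lagrangian C f0 f z y c) = ereal I"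
    "\<And>x. x \<in> C \<Longrightarrow> I + (norm (J - y))\<^sup>2 / (2 * c) \<le> f0 x + J \<bullet> constr f x"
    "\<And>z. z \<in> nonneg_orthant \<Longrightarrow>
       dual_fun C f0 f z \<le> ereal (I + (norm (z - y))\<^sup>2 / (2 * c) - (norm (z - J))\<^sup>2 / (2 * c))"
proof -
  have Cne: "C \<noteq> {}" and Ccv: "convex C" using P by (auto simp: convex_program_def)
  define V where "V x = multiplier_update f x y c" for x
  define A where "A x = f0 x + ((norm (V x))\<^sup>2 - (norm y)\<^sup>2) / (2 * c)" for x
  obtain z0 a where z0: "z0 \<in> nonneg_orthant" and a: "\<And>x. x \<in> C \<Longrightarrow> a \<le> f0 x + z0 \<bullet> constr f x"
    using dual_finite_point[OF D] by blast
  have wk: "f0 x + z \<bullet> constr f x - (norm (z - y))\<^sup>2 / (2 * c)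
      \<le> A x - (norm (z - V x))\<^sup>2 / (2 * c)" if "z \<in> nonneg_orthant" for z x
    using lagrangian_le_aug_lagrangian[OF c that, of f0 x f y] by (simp add: A_def V_def)
  have lowb: "a - (norm (z0 - y))\<^sup>2 / (2 * c) \<le> A x - (norm (z0 - V x))\<^sup>2 / (2 * c)"
    if "x \<in> C" for x
    using wk[OF z0, of x] a[OF that] by linarith
  have "a - (norm (z0 - y))\<^sup>2 / (2 * c) \<le> A x" if "x \<in> C" for x
  proof -
    have "(norm (z0 - V x))\<^sup>2 / (2 * c) \<ge> 0" using c by simp
    then show ?thesis using lowb[OF that] by linarith
  qed
  then have bdd: "bdd_below (A ` C)" by (auto intro!: bdd_belowI)
  define I where "I = (INF x\<in>C. A x)"
  have I_le: "I \<le> A x" if "x \<in> C" for x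
    unfolding I_def using bdd that by (rule cINF_lower)
  \<comment> \<open>The accuracy is the square of the step length \<open>t = 1 / (n + 1)\<close>
    used below, so that dividing the optimality inequality by \<open>t\<close> leaves an error that
    still vanishes.\<close>
  have "\<exists>x\<in>C. A x < I + 1 / (real n + 1)\<^sup>2" for n
  proof (rule ccontr)
    assume "\<not> ?thesis"
    then have "I + 1 / (real n + 1)\<^sup>2 \<le> I"
      unfolding I_def[symmetric] by (subst (2) I_def) (auto intro!: cINF_greatest Cne simp: not_less)
    moreover have "1 / (real n + 1)\<^sup>2 > 0" by simp
    ultimately show False by linarith
  qed
  then obtain X where X: "\<And>n. X n \<in> C" and XI: "\<And>n. A (X n) < I + 1 / (real n + 1)\<^sup>2"
    by metis
  have XI1: "A (X n) \<le> I + 1" for n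
  proof -
    have "1 / (real n + 1)\<^sup>2 \<le> 1" by (simp add: divide_le_eq_1)
    then show ?thesis using XI[of n] by linarith
  qed
  have inv0: "(\<lambda>n. 1 / (real n + 1)) \<longlonglongrightarrow> 0"
    using LIMSEQ_inverse_real_of_nat by (simp add: inverse_eq_divide add.commute)
  have limA: "(\<lambda>n. A (X n)) \<longlonglongrightarrow> I"
  proof (rule tendsto_sandwich[OF _ _ tendsto_const])
    show "\<forall>\<^sub>F n in sequentially. I \<le> A (X n)" using I_le[OF X] by simp
    show "\<forall>\<^sub>F n in sequentially. A (X n) \<le> I + 1 / (real n + 1)\<^sup>2" using XI by (simp add: less_imp_le)
    show "(\<lambda>n. I + 1 / (real n + 1)\<^sup>2) \<longlonglongrightarrow> I"
      using tendsto_add[OF tendsto_const tendsto_power[OF inv0, of 2], of I]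
      by (simp add: power_one_over)
  qed
  \<comment> \<open>The surplus |z0 - V|^2/(2c) in \<open>lowb\<close> bounds the multipliers;
    nothing is claimed about the points \<open>X n\<close>.\<close>
  have "bounded (range (\<lambda>n. V (X n)))"
  proof (rule boundedI)
    fix v assume "v \<in> range (\<lambda>n. V (X n))"
    then obtain n where v: "v = V (X n)" by auto
    have "(norm (z0 - v))\<^sup>2 / (2 * c) \<le> (norm (z0 - y))\<^sup>2 / (2 * c) + (I + 1 - a)"
      using lowb[OF X, of n] XI1[of n] by (simp add: v)
    then have "(norm (z0 - v))\<^sup>2 \<le> (norm (z0 - y))\<^sup>2 + 2 * c * (I + 1 - a)"
      using c by (simp add: field_simps)
    then have "norm (z0 - v) \<le> sqrt ((norm (z0 - y))\<^sup>2 + 2 * c * (I + 1 - a))"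
      by (rule real_le_rsqrt)
    then show "norm v \<le> norm z0 + sqrt ((norm (z0 - y))\<^sup>2 + 2 * c * (I + 1 - a))"
      using norm_triangle_ineq3[of z0 v] by linarith
  qed
  then obtain J r where r: "strict_mono (r :: nat \<Rightarrow> nat)" and J: "(\<lambda>n. V (X (r n))) \<longlonglongrightarrow> J"
    using bounded_imp_convergent_subsequence[of "\<lambda>n. V (X n)"] by (auto simp: o_def)
  show thesis
  proof (rule that[of J I])
    show "J \<in> nonneg_orthant"
      using J by (rule closed_sequentially[OF closed_nonneg_orthant, rotated])
        (simp add: V_def multiplier_update_nonneg)
    have AL: "aug_lagrangian C f0 f x y c = ereal (A x)" if "x \<in> C" for x
      using aug_lagrangian_eq[OF that] by (simp add: A_def V_def)
    show "(INF z. aug_lagrangian C f0 f z y c) = ereal I"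
    proof (rule antisym)
      have "(\<lambda>n. ereal (A (X n))) \<longlonglongrightarrow> ereal I" using limA by simp
      moreover have "(INF z. aug_lagrangian C f0 f z y c) \<le> ereal (A (X n))" for n
        using AL[OF X] by (metis INF_lower UNIV_I)
      ultimately show "(INF z. aug_lagrangian C f0 f z y c) \<le> ereal I"
        using LIMSEQ_le_const by blast
      show "ereal I \<le> (INF z. aug_lagrangian C f0 f z y c)"
      proof (rule INF_greatest)
        fix z
        show "ereal I \<le> aug_lagrangian C f0 f z y c"
          using I_le[of z] AL[of z] by (cases "z \<in> C") (auto simp: aug_lagrangian_def)
      qed
    qed
    show "I + (norm (J - y))\<^sup>2 / (2 * c) \<le> f0 x + J \<bullet> constr f x" if x: "x \<in> C" for x
    proof -
      define d where "d n = y + c *\<^sub>R constr f x - V (X n)" for n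
      \<comment> \<open>Near-minimality of \<open>X n\<close> is tested at the point a fraction
        \<open>t\<close> of the way to \<open>x\<close>. The second-order error stays bounded
        because \<open>d n\<close> depends on \<open>X n\<close> only through
        \<open>V (X n)\<close>.\<close>
      have step: "I + (norm (V (X n) - y))\<^sup>2 / (2 * c) -
          (1 / (real n + 1)) * ((norm (d n))\<^sup>2 / (2 * c) + 1) \<le> f0 x + V (X n) \<bullet> constr f x" for n
      proof -
        define t where "t = 1 / (real n + 1)"
        have t: "0 < t" "t \<le> 1" by (auto simp: t_def)
        have tt: "A (X n) < I + t\<^sup>2" using XI[of n] by (simp add: t_def power_one_over)
        let ?v = "V (X n)"
        let ?w = "(1 - t) *\<^sub>R X n + t *\<^sub>R x"
        have "?w \<in> C" using convexD_alt[OF Ccv X x, of t] t by auto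
        then have "I \<le> A ?w" by (rule I_le)
        also have "\<dots> \<le> (1 - t) * f0 (X n) + t * f0 x + ((norm (?v + t *\<^sub>R d n))\<^sup>2 - (norm y)\<^sup>2) / (2 * c)"
          using aug_lagrangian_segment[OF P c, where t = t and x = x and x' = "X n" and y = y] t by (simp add: A_def V_def d_def)
        also have "(norm (?v + t *\<^sub>R d n))\<^sup>2 = (norm ?v)\<^sup>2 + 2 * t * (?v \<bullet> d n) + t\<^sup>2 * (norm (d n))\<^sup>2"
          unfolding power2_norm_eq_inner
          by (simp add: inner_add_left inner_add_right inner_commute power2_eq_square algebra_simps)
        also have "(1 - t) * f0 (X n) + t * f0 x +
            ((norm ?v)\<^sup>2 + 2 * t * (?v \<bullet> d n) + t\<^sup>2 * (norm (d n))\<^sup>2 - (norm y)\<^sup>2) / (2 * c)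
          = A (X n) + t * (f0 x - f0 (X n) + (?v \<bullet> d n) / c + t * ((norm (d n))\<^sup>2 / (2 * c)))"
          using c by (simp add: A_def field_simps power2_eq_square)
        finally have "t * (- (f0 x - f0 (X n) + (?v \<bullet> d n) / c + t * ((norm (d n))\<^sup>2 / (2 * c)))) \<le> t * t"
          using tt by (simp add: power2_eq_square algebra_simps)
        then have "- (f0 x - f0 (X n) + (?v \<bullet> d n) / c + t * ((norm (d n))\<^sup>2 / (2 * c))) \<le> t"
          using t by (subst (asm) mult_le_cancel_left_pos) auto
        moreover have "f0 (X n) = A (X n) - ((norm ?v)\<^sup>2 - (norm y)\<^sup>2) / (2 * c)"
          by (simp add: A_def)
        moreover have "(?v \<bullet> d n) / c = ?v \<bullet> constr f x
            - (norm (?v - y))\<^sup>2 / (2 * c) - ((norm ?v)\<^sup>2 - (norm y)\<^sup>2) / (2 * c)"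
        proof -
          have "2 * (?v \<bullet> d n) = 2 * c * (?v \<bullet> constr f x) - (norm (?v - y))\<^sup>2
              - ((norm ?v)\<^sup>2 - (norm y)\<^sup>2)"
            by (simp add: d_def power2_norm_eq_inner inner_diff_left inner_diff_right
                inner_add_right inner_commute algebra_simps)
          then have "2 * (?v \<bullet> d n) / (2 * c) = (2 * c * (?v \<bullet> constr f x) - (norm (?v - y))\<^sup>2
              - ((norm ?v)\<^sup>2 - (norm y)\<^sup>2)) / (2 * c)" by (rule arg_cong)
          then show ?thesis using c by (simp add: diff_divide_distrib)
        qed
        ultimately have "A (X n) + (norm (?v - y))\<^sup>2 / (2 * c) - (t * ((norm (d n))\<^sup>2 / (2 * c)) + t)
            \<le> f0 x + ?v \<bullet> constr f x" by linarith
        then show ?thesis using I_le[OF X, of n] by (simp add: t_def[symmetric] distrib_left)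
      qed
      have inv: "(\<lambda>n. 1 / (real (r n) + 1)) \<longlonglongrightarrow> 0"
        using LIMSEQ_subseq_LIMSEQ[OF inv0 r] by (simp add: o_def)
      have dl: "(\<lambda>n. d (r n)) \<longlonglongrightarrow> y + c *\<^sub>R constr f x - J"
        unfolding d_def by (intro tendsto_intros J)
      have "(\<lambda>n. I + (norm (V (X (r n)) - y))\<^sup>2 / (2 * c) -
          (1 / (real (r n) + 1)) * ((norm (d (r n)))\<^sup>2 / (2 * c) + 1)) \<longlonglongrightarrow>
          I + (norm (J - y))\<^sup>2 / (2 * c) - 0 * ((norm (y + c *\<^sub>R constr f x - J))\<^sup>2 / (2 * c) + 1)"
        using c by (intro tendsto_intros J inv dl) auto
      moreover have "(\<lambda>n. f0 x + V (X (r n)) \<bullet> constr f x) \<longlonglongrightarrow> f0 x + J \<bullet> constr f x"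
        by (intro tendsto_intros J)
      ultimately show ?thesis
        using step LIMSEQ_le[of _ _ _ "f0 x + J \<bullet> constr f x"] by fastforce
    qed
    show "dual_fun C f0 f z \<le> ereal (I + (norm (z - y))\<^sup>2 / (2 * c) - (norm (z - J))\<^sup>2 / (2 * c))"
      if z: "z \<in> nonneg_orthant" for z
    proof (rule LIMSEQ_le_const)
      have "(\<lambda>n. A (X (r n)) + (norm (z - y))\<^sup>2 / (2 * c) - (norm (z - V (X (r n))))\<^sup>2 / (2 * c)) \<longlonglongrightarrow>
          I + (norm (z - y))\<^sup>2 / (2 * c) - (norm (z - J))\<^sup>2 / (2 * c)"
        using c LIMSEQ_subseq_LIMSEQ[OF limA r] by (intro tendsto_intros J) (auto simp: o_def)
      then show "(\<lambda>n. ereal (A (X (r n)) + (norm (z - y))\<^sup>2 / (2 * c) - (norm (z - V (X (r n))))\<^sup>2 / (2 * c)))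
          \<longlonglongrightarrow> ereal (I + (norm (z - y))\<^sup>2 / (2 * c) - (norm (z - J))\<^sup>2 / (2 * c))"
        by simp
      have "dual_fun C f0 f z \<le>
          ereal (A (X n) + (norm (z - y))\<^sup>2 / (2 * c) - (norm (z - V (X n)))\<^sup>2 / (2 * c))" for n
        using wk[OF z, of "X n"] by (intro order_trans[OF dual_fun_le[OF X[of n]]]) simp
      then show "\<exists>N. \<forall>n\<ge>N. dual_fun C f0 f z \<le> ereal (A (X (r n)) + (norm (z - y))\<^sup>2 / (2 * c)
          - (norm (z - V (X (r n))))\<^sup>2 / (2 * c))" by blast
    qed
  qed
qed

section \<open>Halpern iteration of inexact resolvents\<close>

text \<open>The assumption says that the triangle \<open>p\<close>, \<open>u\<close>,
  \<open>v\<close> has no acute angle at \<open>u\<close>, so Pythagoras holds as an inequality. It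
  is used with \<open>u\<close> a resolvent of \<open>v\<close> and \<open>p\<close> a
  solution.\<close>

lemma resolvent_quasi_firm:
  fixes p u v :: "'a::real_inner"
  assumes "0 \<le> (p - u) \<bullet> (u - v)"
  shows "(norm (u - p))\<^sup>2 \<le> (norm (v - p))\<^sup>2 - (norm (u - v))\<^sup>2"
proof -
  have "(norm (v - p))\<^sup>2 = (norm (u - p))\<^sup>2 + (norm (u - v))\<^sup>2 + 2 * ((p - u) \<bullet> (u - v))"
    by (simp add: power2_norm_eq_inner inner_diff_left inner_diff_right inner_commute algebra_simps)
  with assms show ?thesis by linarith
qed

lemma resolvent_quasi_nonexpansive:
  fixes p u v :: "'a::real_inner"
  assumes "0 \<le> (p - u) \<bullet> (u - v)"
  shows "norm (u - p) \<le> norm (v - p)"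
proof (rule power2_le_imp_le)
  show "(norm (u - p))\<^sup>2 \<le> (norm (v - p))\<^sup>2"
    using resolvent_quasi_firm[OF assms] zero_le_power2[of "norm (u - v)"] by linarith
qed simp

text \<open>The iterates stay in balls around \<open>p\<close> whose radius grows by
  \<open>\<epsilon> k\<close> per step: the resolvent does not move away from \<open>p\<close>, and
  averaging with the anchor \<open>y 0\<close>, which lies in every such ball, does not leave a
  convex set.\<close>

lemma halpern_bounded:
  fixes y J yb :: "nat \<Rightarrow> 'a::real_inner"
  assumes rec: "\<And>k. y (Suc k) = (1 / (real k + 2)) *\<^sub>R y 0 + ((real k + 1) / (real k + 2)) *\<^sub>R yb k"
    and err: "\<And>k. norm (yb k - J k) \<le> \<epsilon> k" and sm: "summable \<epsilon>"
    and firm: "\<And>k. 0 \<le> (p - J k) \<bullet> (J k - y k)"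
  shows "bounded (range y)"
proof -
  have e0: "0 \<le> \<epsilon> k" for k by (rule order_trans[OF norm_ge_zero err])
  have *: "norm (y k - p) \<le> norm (y 0 - p) + (\<Sum>j<k. \<epsilon> j)" for k
  proof (induction k)
    case (Suc k)
    define a b where "a = 1 / (real k + 2)" and "b = (real k + 1) / (real k + 2)"
    let ?R = "norm (y 0 - p) + (\<Sum>j<Suc k. \<epsilon> j)"
    have ab: "a \<ge> 0" "b \<ge> 0" by (auto simp: a_def b_def)
    have ab1: "b = 1 - a" by (simp add: a_def b_def field_simps)
    have "norm (yb k - p) \<le> norm (yb k - J k) + norm (J k - p)"
      using norm_triangle_ineq[of "yb k - J k" "J k - p"] by simp
    also have "\<dots> \<le> \<epsilon> k + norm (y k - p)"
      using err[of k] resolvent_quasi_nonexpansive[OF firm[of k]] by linarith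
    also have "\<dots> \<le> ?R" using Suc by simp
    finally have 1: "norm (yb k - p) \<le> ?R" .
    have 2: "norm (y 0 - p) \<le> ?R" using e0 by (simp add: sum_nonneg)
    have "y (Suc k) = a *\<^sub>R y 0 + b *\<^sub>R yb k"
      using rec[of k] by (simp only: a_def b_def)
    then have "y (Suc k) - p = a *\<^sub>R (y 0 - p) + b *\<^sub>R (yb k - p)"
      by (simp add: ab1 algebra_simps)
    then have "norm (y (Suc k) - p) \<le> a * norm (y 0 - p) + b * norm (yb k - p)"
      using norm_triangle_ineq[of "a *\<^sub>R (y 0 - p)" "b *\<^sub>R (yb k - p)"] ab by simp
    also have "\<dots> \<le> a * ?R + b * ?R"
      by (rule add_mono[OF mult_left_mono[OF 2 ab(1)] mult_left_mono[OF 1 ab(2)]])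
    also have "\<dots> = ?R" by (simp add: ab1 algebra_simps)
    finally show ?case .
  qed simp
  show ?thesis
  proof (rule boundedI)
    fix v assume "v \<in> range y"
    then obtain k where v: "v = y k" by auto
    have "(\<Sum>j<k. \<epsilon> j) \<le> suminf \<epsilon>" using sm e0 by (intro sum_le_suminf) auto
    then show "norm v \<le> norm p + norm (y 0 - p) + suminf \<epsilon>"
      unfolding v using *[of k] norm_triangle_ineq2[of "y k" p] by linarith
  qed
qed

text \<open>The weights \<open>1 - 1 / (k + 2)\<close> telescope to \<open>(N + 1) / (k + 1)\<close>.\<close>

lemma harmonic_contraction_tendsto_0:
  fixes s b e :: "nat \<Rightarrow> real"
  assumes s0: "\<And>k. 0 \<le> s k" and e0: "\<And>k. 0 \<le> e k" and sm: "summable e"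
    and rec: "\<And>k. s (Suc k) \<le> (1 - 1 / (real k + 2)) * s k + 1 / (real k + 2) * b k + e k"
    and b: "\<And>\<eta>. \<eta> > 0 \<Longrightarrow> \<forall>\<^sub>F k in sequentially. b k \<le> \<eta>"
  shows "s \<longlonglongrightarrow> 0"
proof (rule order_tendstoI)
  fix a :: real assume "a < 0"
  then show "\<forall>\<^sub>F k in sequentially. a < s k"
    using less_le_trans[OF \<open>a < 0\<close> s0] by simp
next
  fix a :: real assume a: "0 < a"
  \<comment> \<open>Three contributions of at most \<open>\<eta>\<close> each will bound
    \<open>s k\<close>: the limiting size of \<open>b\<close>, the decayed starting value and the
    tail of \<open>e\<close>.\<close>
  define \<eta> where "\<eta> = a / 4"
  have \<eta>: "\<eta> > 0" using a by (simp add: \<eta>_def)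
  obtain N1 where N1: "\<And>k. k \<ge> N1 \<Longrightarrow> b k \<le> \<eta>"
    using b[OF \<eta>] by (auto simp: eventually_sequentially)
  obtain N2 where N2: "\<And>m n. m \<ge> N2 \<Longrightarrow> norm (sum e {m..<n}) < \<eta>"
    using sm[unfolded summable_Cauchy] \<eta> by blast
  define N where "N = max N1 N2"
  have *: "k \<ge> N \<Longrightarrow> s k - \<eta> \<le> (real N + 1) / (real k + 1) * \<bar>s N - \<eta>\<bar> + sum e {N..<k}" for k
  proof (induction k rule: dec_induct)
    case (step k)
    define u where "u = 1 / (real k + 2)"
    have l: "0 \<le> 1 - u" "1 - u \<le> 1" "0 \<le> u" by (auto simp: u_def)
    have u1: "1 - u = (real k + 1) / (real k + 2)" by (simp add: u_def field_simps)
    have "u * b k \<le> u * \<eta>"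
      using N1[of k] step N_def l by (intro mult_left_mono) auto
    \<comment> \<open>With \<open>b k\<close> replaced by \<open>\<eta>\<close> and without
      \<open>e\<close>, the recursion has the fixed point \<open>\<eta>\<close>; subtracting it
      leaves a pure contraction plus the error.\<close>
    then have "s (Suc k) - \<eta> \<le> (1 - u) * (s k - \<eta>) + e k"
      using rec[of k] unfolding u_def[symmetric] by (simp add: algebra_simps)
    also have "\<dots> \<le> (1 - u) * ((real N + 1) / (real k + 1) * \<bar>s N - \<eta>\<bar> + sum e {N..<k}) + e k"
      using step.IH l by (intro add_mono mult_left_mono) auto
    also have "\<dots> = (1 - u) * ((real N + 1) / (real k + 1)) * \<bar>s N - \<eta>\<bar>
        + (1 - u) * sum e {N..<k} + e k"
      by (simp only: distrib_left mult.assoc)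
    also have "(1 - u) * ((real N + 1) / (real k + 1)) = (real N + 1) / (real (Suc k) + 1)"
      by (simp add: u1 divide_simps)
    also have "(1 - u) * sum e {N..<k} \<le> 1 * sum e {N..<k}"
      using l e0 by (intro mult_right_mono sum_nonneg) auto
    finally show ?case using step by simp
  qed simp
  have "(\<lambda>k. (real N + 1) * \<bar>s N - \<eta>\<bar> * (1 / (real k + 1))) \<longlonglongrightarrow> (real N + 1) * \<bar>s N - \<eta>\<bar> * 0"
    using LIMSEQ_inverse_real_of_nat
    by (intro tendsto_intros) (simp add: inverse_eq_divide add.commute)
  then have "\<forall>\<^sub>F k in sequentially. (real N + 1) * \<bar>s N - \<eta>\<bar> * (1 / (real k + 1)) < \<eta>"
    using \<eta> order_tendstoD(2) by fastforce
  then show "\<forall>\<^sub>F k in sequentially. s k < a"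
    using eventually_ge_at_top[of N]
  proof eventually_elim
    case (elim k)
    have "sum e {N..<k} < \<eta>" using N2[of N k] by (simp add: N_def)
    moreover have "(real N + 1) / (real k + 1) * \<bar>s N - \<eta>\<bar> < \<eta>" using elim(1) by simp
    moreover have "a = 4 * \<eta>" by (simp add: \<eta>_def)
    ultimately show ?case using *[OF elim(2)] \<eta> by linarith
  qed
qed

text \<open>
  The bound \<open>b k = 2 \<langle>y 0 - p, y (k + 1) - p\<rangle> - |J k - y k|\<^sup>2 / (4 \<lambda>\<^sub>k)\<close> has nonpositive upper
  limit: along a subsequence on which it stays above a positive number, \<open>|J k - y k|\<^sup>2\<close> is \<open>O(\<lambda>\<^sub>k)\<close>, so the
  cluster points of \<open>y (k + 1)\<close> lie in \<open>K\<close>.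
\<close>

proposition halpern_convergence:
  fixes y J yb :: "nat \<Rightarrow> 'a::euclidean_space"
  assumes rec: "\<And>k. y (Suc k) = (1 / (real k + 2)) *\<^sub>R y 0 + ((real k + 1) / (real k + 2)) *\<^sub>R yb k"
    and err: "\<And>k. norm (yb k - J k) \<le> \<epsilon> k" and sm: "summable \<epsilon>"
    and K: "closed K" "convex K" "K \<noteq> {}"
    and firm: "\<And>k p. p \<in> K \<Longrightarrow> 0 \<le> (p - J k) \<bullet> (J k - y k)"
    and cluster: "\<And>r q. strict_mono r \<Longrightarrow> (\<lambda>k. J (r k) - y (r k)) \<longlonglongrightarrow> 0 \<Longrightarrow>
      (\<lambda>k. J (r k)) \<longlonglongrightarrow> q \<Longrightarrow> q \<in> K"
  shows "y \<longlonglongrightarrow> closest_point K (y 0)" and "J \<longlonglongrightarrow> closest_point K (y 0)"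
proof -
  define p where "p = closest_point K (y 0)"
  define l where "l k = 1 / (real k + 2)" for k
  have pK: "p \<in> K" unfolding p_def by (rule closest_point_in_set[OF K(1,3)])
  have proj: "(y 0 - p) \<bullet> (q - p) \<le> 0" if "q \<in> K" for q
    unfolding p_def by (rule closest_point_dot[OF K(2,1) that])
  have l: "0 < l k" "l k \<le> 1/2" for k by (auto simp: l_def field_simps)
  have l0: "l \<longlonglongrightarrow> 0"
  proof -
    have "(\<lambda>k. inverse (real (Suc (Suc k)))) \<longlonglongrightarrow> 0"
      by (rule LIMSEQ_Suc[OF LIMSEQ_inverse_real_of_nat])
    then show ?thesis by (simp add: l_def[abs_def] inverse_eq_divide add.commute)
  qed
  have rec': "y (Suc k) = l k *\<^sub>R y 0 + (1 - l k) *\<^sub>R yb k" for k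
  proof -
    have "(real k + 1) / (real k + 2) = 1 - l k" by (simp add: l_def field_simps)
    then show ?thesis using rec[of k] by (simp add: l_def)
  qed
  have e0: "0 \<le> \<epsilon> k" for k by (rule order_trans[OF norm_ge_zero err])
  have eps0: "\<epsilon> \<longlonglongrightarrow> 0" using sm by (rule summable_LIMSEQ_zero)
  have "bounded (range y)" by (rule halpern_bounded[OF rec err sm firm[OF pK]])
  then obtain B where B: "\<And>k. norm (y k) \<le> B" by (auto simp: bounded_iff)
  \<comment> \<open>This bounds \<open>2 * norm (J k - p) + \<epsilon> k\<close>, the factor of
    \<open>\<epsilon> k\<close> when \<open>norm (J k - p) + \<epsilon> k\<close> is
    squared.\<close>
  define M where "M = 2 * (B + norm p) + suminf \<epsilon>"
  have yp: "norm (y k - p) \<le> B + norm p" for k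
    using norm_triangle_ineq4[of "y k" p] B[of k] by linarith
  have ef: "\<epsilon> k \<le> suminf \<epsilon>" for k
    using sum_le_suminf[OF sm, of "{k}"] e0 by simp
  have Jp: "norm (J k - p) \<le> B + norm p" for k
    by (rule order_trans[OF resolvent_quasi_nonexpansive[OF firm[OF pK]] yp])
  have ybp: "norm (yb k - p) \<le> norm (J k - p) + \<epsilon> k" for k
    using norm_triangle_ineq[of "yb k - J k" "J k - p"] err[of k] by simp
  have M0: "0 \<le> M"
  proof -
    have "0 \<le> suminf \<epsilon>" by (rule suminf_nonneg[OF sm e0])
    moreover have "0 \<le> 2 * (B + norm p)"
      using order_trans[OF norm_ge_zero yp[of 0]] by simp
    ultimately show ?thesis unfolding M_def by (rule add_nonneg_nonneg[rotated])
  qed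
  define D where "D k = (norm (J k - y k))\<^sup>2" for k
  \<comment> \<open>Since \<open>l k\<close> is at most 1/2, \<open>D k\<close> enters the recursion
    with a coefficient of at least 1/4 in size; dividing by \<open>l k\<close> moves this gain into
    the term weighted by \<open>l k\<close>.\<close>
  define b where "b k = 2 * ((y 0 - p) \<bullet> (y (Suc k) - p)) - D k / (4 * l k)" for k
  define s where "s k = (norm (y k - p))\<^sup>2" for k
  have srec: "s (Suc k) \<le> (1 - l k) * s k + l k * b k + M * \<epsilon> k" for k
  proof -
    let ?a = "l k *\<^sub>R (y 0 - p)" and ?c = "(1 - l k) *\<^sub>R (yb k - p)"
    have eq: "y (Suc k) - p = ?a + ?c" by (simp add: rec' algebra_simps)
    have "(norm (yb k - p))\<^sup>2 \<le> (norm (J k - p) + \<epsilon> k)\<^sup>2"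
      using ybp by (intro power_mono) auto
    also have "\<dots> = (norm (J k - p))\<^sup>2 + \<epsilon> k * (2 * norm (J k - p) + \<epsilon> k)"
      by (simp add: power2_eq_square algebra_simps)
    also have "\<dots> \<le> (norm (J k - p))\<^sup>2 + \<epsilon> k * M"
      using Jp[of k] ef[of k] e0[of k] by (intro add_mono mult_left_mono) (auto simp: M_def)
    also have "\<dots> \<le> s k - D k + \<epsilon> k * M"
      using resolvent_quasi_firm[OF firm[OF pK], of k] by (simp add: s_def D_def)
    finally have yb2: "(norm (yb k - p))\<^sup>2 \<le> s k - D k + \<epsilon> k * M" .
    have l2: "(1 - l k)\<^sup>2 \<le> 1 - l k" "(1/2)\<^sup>2 \<le> (1 - l k)\<^sup>2" "(1 - l k)\<^sup>2 \<le> 1"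
    proof -
      show "(1 - l k)\<^sup>2 \<le> 1 - l k"
        unfolding power2_eq_square using l[of k] by (intro mult_left_le) auto
      show "(1/2)\<^sup>2 \<le> (1 - l k)\<^sup>2" using l[of k] by (intro power_mono) auto
      show "(1 - l k)\<^sup>2 \<le> 1" using l[of k] by (intro power_le_one) auto
    qed
    \<comment> \<open>Expanding around the new iterate keeps \<open>y (Suc k) - p\<close> in the
      inner product, so its sign in the limit is decided by cluster points of
      \<open>y (Suc k)\<close>.\<close>
    have "s (Suc k) = (norm ?c)\<^sup>2 + 2 * (?a \<bullet> (?a + ?c)) - (norm ?a)\<^sup>2"
    proof -
      have "(norm (u + v))\<^sup>2 = (norm v)\<^sup>2 + 2 * (u \<bullet> (u + v)) - (norm u)\<^sup>2" for u v :: 'a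
        by (simp add: power2_norm_eq_inner inner_add_left inner_add_right inner_commute)
      then show ?thesis unfolding s_def eq .
    qed
    also have "\<dots> \<le> (norm ?c)\<^sup>2 + 2 * (?a \<bullet> (?a + ?c))" by simp
    also have "\<dots> = (1 - l k)\<^sup>2 * (norm (yb k - p))\<^sup>2 + 2 * l k * ((y 0 - p) \<bullet> (y (Suc k) - p))"
      unfolding eq[symmetric] by (simp add: power_mult_distrib)
    also have "(1 - l k)\<^sup>2 * (norm (yb k - p))\<^sup>2 \<le> (1 - l k)\<^sup>2 * (s k - D k + \<epsilon> k * M)"
      using yb2 by (intro mult_left_mono) auto
    also have "\<dots> = (1 - l k)\<^sup>2 * s k - (1 - l k)\<^sup>2 * D k + (1 - l k)\<^sup>2 * (\<epsilon> k * M)"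
      by (simp add: algebra_simps)
    also have "\<dots> \<le> (1 - l k) * s k - (1/2)\<^sup>2 * D k + 1 * (\<epsilon> k * M)"
      using l2 e0[of k] M0 by (intro add_mono diff_mono mult_right_mono) (auto simp: s_def D_def)
    also have "(1/2)\<^sup>2 * D k = l k * (D k / (4 * l k))"
      using l[of k] by (simp add: field_simps power2_eq_square)
    finally show ?thesis by (simp add: b_def algebra_simps)
  qed
  have yb_bd: "norm (y 0 - yb k) \<le> 2 * M" for k
  proof -
    have "norm (y 0 - yb k) \<le> norm (y 0 - p) + norm (yb k - p)"
      using norm_triangle_ineq4[of "y 0 - p" "yb k - p"] by simp
    also have "\<dots> \<le> M" using yp[of 0] ybp[of k] Jp[of k] ef[of k] by (simp add: M_def)
    finally show ?thesis using M0 by linarith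
  qed
  have yJ: "(\<lambda>k. y (Suc k) - J k) \<longlonglongrightarrow> 0"
  proof (rule tendsto_norm_zero_cancel, rule tendsto_sandwich[OF _ _ tendsto_const])
    show "\<forall>\<^sub>F k in sequentially. 0 \<le> norm (y (Suc k) - J k)" by simp
    have "norm (y (Suc k) - J k) \<le> l k * (2 * M) + \<epsilon> k" for k
    proof -
      have eq: "y (Suc k) - J k = l k *\<^sub>R (y 0 - yb k) + (yb k - J k)"
        by (simp add: rec' algebra_simps)
      have "norm (y (Suc k) - J k) \<le> l k * norm (y 0 - yb k) + norm (yb k - J k)"
        unfolding eq
        using norm_triangle_ineq[of "l k *\<^sub>R (y 0 - yb k)" "yb k - J k"] less_imp_le[OF l(1)[of k]]
        by simp
      also have "\<dots> \<le> l k * (2 * M) + \<epsilon> k"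
        using yb_bd err l[of k] by (intro add_mono mult_left_mono) auto
      finally show ?thesis .
    qed
    then show "\<forall>\<^sub>F k in sequentially. norm (y (Suc k) - J k) \<le> l k * (2 * M) + \<epsilon> k" by simp
    show "(\<lambda>k. l k * (2 * M) + \<epsilon> k) \<longlonglongrightarrow> 0"
      using tendsto_add[OF tendsto_mult_right[OF l0, of "2 * M"] eps0] by simp
  qed
  have blim: "\<forall>\<^sub>F k in sequentially. b k \<le> \<eta>" if \<eta>: "\<eta> > 0" for \<eta>
  proof (rule ccontr)
    assume "\<not> ?thesis"
    then have "infinite {k. b k > \<eta>}"
      unfolding not_eventually cofinite_eq_sequentially[symmetric] frequently_cofinite not_le .
    from infinite_enumerate[OF this]
    obtain r0 :: "nat \<Rightarrow> nat" where r0: "strict_mono r0" "\<And>n. b (r0 n) > \<eta>" by auto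
    have "bounded (range (\<lambda>n. y (Suc (r0 n))))"
      using \<open>bounded (range y)\<close> by (rule bounded_subset) auto
    then obtain q r1 where r1: "strict_mono (r1 :: nat \<Rightarrow> nat)"
      and q: "(\<lambda>n. y (Suc (r0 (r1 n)))) \<longlonglongrightarrow> q"
      using bounded_imp_convergent_subsequence[of "\<lambda>n. y (Suc (r0 n))"] by (auto simp: o_def)
    define r where "r = r0 \<circ> r1"
    have r: "strict_mono r" unfolding r_def using r0(1) r1 by (rule strict_mono_o)
    have br: "b (r n) > \<eta>" for n using r0 by (simp add: r_def)
    have yq: "(\<lambda>n. y (Suc (r n))) \<longlonglongrightarrow> q" using q by (simp add: r_def)
    let ?H = "norm (y 0 - p) * (B + norm p)"
    have H: "(y 0 - p) \<bullet> (y (Suc k) - p) \<le> ?H" for k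
      using norm_cauchy_schwarz[of "y 0 - p" "y (Suc k) - p"] mult_left_mono[OF yp[of "Suc k"], of "norm (y 0 - p)"]
      by simp
    have "(\<lambda>n. D (r n)) \<longlonglongrightarrow> 0"
    proof (rule tendsto_sandwich[OF _ _ tendsto_const])
      show "\<forall>\<^sub>F n in sequentially. 0 \<le> D (r n)" by (simp add: D_def)
      have "D k \<le> l k * (8 * ?H)" if "b k > \<eta>" for k
      proof -
        have "D k / (4 * l k) \<le> 2 * ?H" using that \<eta> H[of k] by (simp add: b_def)
        then show ?thesis using l[of k] by (simp add: field_simps)
      qed
      then show "\<forall>\<^sub>F n in sequentially. D (r n) \<le> l (r n) * (8 * ?H)" using br by simp
      show "(\<lambda>n. l (r n) * (8 * ?H)) \<longlonglongrightarrow> 0"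
        using tendsto_mult_right[OF LIMSEQ_subseq_LIMSEQ[OF l0 r], of "8 * ?H"] by (simp add: o_def)
    qed
    then have "(\<lambda>n. sqrt (D (r n))) \<longlonglongrightarrow> sqrt 0" by (rule tendsto_real_sqrt)
    then have Jy: "(\<lambda>n. J (r n) - y (r n)) \<longlonglongrightarrow> 0"
      using tendsto_norm_zero_cancel[of "\<lambda>n. J (r n) - y (r n)"] by (simp add: D_def)
    have "(\<lambda>n. y (Suc (r n)) - (y (Suc (r n)) - J (r n))) \<longlonglongrightarrow> q - 0"
      using LIMSEQ_subseq_LIMSEQ[OF yJ r] by (intro tendsto_diff yq) (simp add: o_def)
    then have "q \<in> K" using cluster[OF r Jy] by simp
    have "(\<lambda>n. 2 * ((y 0 - p) \<bullet> (y (Suc (r n)) - p))) \<longlonglongrightarrow> 2 * ((y 0 - p) \<bullet> (q - p))"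
      by (intro tendsto_intros yq)
    moreover have "\<eta> \<le> 2 * ((y 0 - p) \<bullet> (y (Suc (r n)) - p))" for n
    proof -
      have "0 \<le> D (r n) / (4 * l (r n))" using l[of "r n"] by (simp add: D_def)
      then show ?thesis using br[of n] by (simp add: b_def)
    qed
    ultimately have "\<eta> \<le> 2 * ((y 0 - p) \<bullet> (q - p))"
      using LIMSEQ_le_const by blast
    then show False using proj[OF \<open>q \<in> K\<close>] \<eta> by linarith
  qed
  have "s \<longlonglongrightarrow> 0"
  proof (rule harmonic_contraction_tendsto_0[where b = b and e = "\<lambda>k. M * \<epsilon> k"])
    show "0 \<le> s k" for k by (simp add: s_def)
    show "0 \<le> M * \<epsilon> k" for k using M0 e0 by simp
    show "summable (\<lambda>k. M * \<epsilon> k)" using sm by (rule summable_mult)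
    show "s (Suc k) \<le> (1 - 1 / (real k + 2)) * s k + 1 / (real k + 2) * b k + M * \<epsilon> k" for k
      using srec[of k] by (simp only: l_def)
  qed (rule blim)
  then have "(\<lambda>n. sqrt (s n)) \<longlonglongrightarrow> sqrt 0" by (rule tendsto_real_sqrt)
  then have "(\<lambda>n. y n - p) \<longlonglongrightarrow> 0"
    using tendsto_norm_zero_cancel[of "\<lambda>n. y n - p"] by (simp add: s_def)
  then have yp: "y \<longlonglongrightarrow> p" by (rule LIM_zero_cancel)
  then show "y \<longlonglongrightarrow> closest_point K (y 0)" by (simp add: p_def)
  have "(\<lambda>n. y (Suc n) - (y (Suc n) - J n)) \<longlonglongrightarrow> p - 0"
    by (intro tendsto_diff yJ LIMSEQ_Suc yp)
  then show "J \<longlonglongrightarrow> closest_point K (y 0)" by (simp add: p_def)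
qed

section \<open>The dual sequence\<close>

text \<open>As an infimum of functions affine in the multiplier, the dual is upper semicontinuous.
  This takes the form of a passage to the limit for each fixed \<open>x\<close>, which also copes
  with infinite values.\<close>

lemma dual_fun_attains_sup:
  fixes f :: "'m::finite \<Rightarrow> real^'n \<Rightarrow> real"
  assumes "compact S" "S \<noteq> {}"
  obtains p where "p \<in> S" "\<And>z. z \<in> S \<Longrightarrow> dual_fun C f0 f z \<le> dual_fun C f0 f p"
proof -
  define v where "v = (SUP z\<in>S. dual_fun C f0 f z)"
  obtain h where h: "incseq h" "range h \<subseteq> dual_fun C f0 f ` S" "v = Sup (range h)"
    using Sup_countable_SUP[of "dual_fun C f0 f ` S"] assms(2) unfolding v_def by blast
  have g: "\<And>n. h n \<in> dual_fun C f0 f ` S" "h \<longlonglongrightarrow> v"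
    using h LIMSEQ_SUP[OF h(1)] by auto
  have "\<exists>z. z \<in> S \<and> h n = dual_fun C f0 f z" for n using g(1)[of n] by blast
  then obtain z where z: "\<And>n. z n \<in> S" "\<And>n. h n = dual_fun C f0 f (z n)" by metis
  obtain p r where p: "p \<in> S" and r: "strict_mono (r :: nat \<Rightarrow> nat)" and lim: "(\<lambda>n. z (r n)) \<longlonglongrightarrow> p"
    using assms(1)[unfolded compact_def, rule_format, of z] z(1) by (auto simp: o_def)
  have "v \<le> dual_fun C f0 f p"
    unfolding dual_fun_eq
  proof (rule INF_greatest)
    fix x assume "x \<in> C"
    then have "h (r n) \<le> ereal (f0 x + z (r n) \<bullet> constr f x)" for n
      unfolding z(2) by (rule dual_fun_le)
    moreover have "(\<lambda>n. h (r n)) \<longlonglongrightarrow> v"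
      using LIMSEQ_subseq_LIMSEQ[OF g(2) r] by (simp add: o_def)
    moreover have "(\<lambda>n. ereal (f0 x + z (r n) \<bullet> constr f x)) \<longlonglongrightarrow> ereal (f0 x + p \<bullet> constr f x)"
      by (intro tendsto_intros lim)
    ultimately show "v \<le> ereal (f0 x + p \<bullet> constr f x)"
      using LIMSEQ_le by blast
  qed
  then show thesis
    using order_trans[OF SUP_upper[of _ S "dual_fun C f0 f"]] p unfolding v_def by (intro that) blast+
qed

section \<open>Weak duality with asymptotic values, and dual attainment under the Slater
  condition\<close>

lemma dual_fun_le_dual_value:
  "z \<in> nonneg_orthant \<Longrightarrow> dual_fun C f0 f z \<le> dual_value C f0 f"
  unfolding dual_value_def by (rule SUP_upper)

lemma dual_optimal_value: "dual_optimal C f0 f p \<Longrightarrow> dual_value C f0 f = dual_fun C f0 f p"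
  unfolding dual_optimal_def dual_value_def by (intro antisym SUP_least SUP_upper) auto

text \<open>Along an asymptotically feasible sequence the penalty
  \<open>z \<bullet> constr f (x k)\<close> is eventually below any \<open>e > 0\<close>, so the
  usual weak duality estimate holds up to \<open>e\<close> in the limit.\<close>

lemma weak_duality_asym:
  fixes f :: "'m::finite \<Rightarrow> real^'n \<Rightarrow> real"
  shows "dual_value C f0 f \<le> asym_inf C f0 f"
  unfolding dual_value_def asym_inf_def
proof (intro SUP_least INF_greatest)
  fix z :: "real^'m" and x :: "nat \<Rightarrow> real^'n"
  assume z: "z \<in> nonneg_orthant" and "x \<in> {x. asym_feasible C f x}"
  then have xC: "\<And>k. x k \<in> C" and lim: "\<And>i. limsup (\<lambda>k. ereal (f i (x k))) \<le> 0"
    by (auto simp: asym_feasible_def)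
  show "dual_fun C f0 f z \<le> limsup (\<lambda>k. ereal (f0 (x k)))"
  proof (rule ereal_le_epsilon2)
    fix e :: real assume e: "0 < e"
    \<comment> \<open>Chosen so that the sum of the multipliers times \<open>d\<close> is at most
      \<open>e\<close>; the added 1 keeps the denominator positive when
      \<open>z = 0\<close>.\<close>
    define d where "d = e / (1 + (\<Sum>i\<in>UNIV. z $ i))"
    have sz: "0 \<le> (\<Sum>i\<in>UNIV. z $ i)" using z by (intro sum_nonneg) (simp add: nonneg_orthant_def)
    then have d: "0 < d" using e by (simp add: d_def)
    have "\<forall>\<^sub>F k in sequentially. ereal (f i (x k)) < ereal d" for i
      using lim[of i] d by (intro Limsup_lessD) (auto intro: le_less_trans)
    then have "\<forall>\<^sub>F k in sequentially. \<forall>i. f i (x k) < d"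
      by (simp add: eventually_all_finite)
    then have ev: "\<forall>\<^sub>F k in sequentially. dual_fun C f0 f z \<le> ereal (f0 (x k)) + ereal e"
    proof eventually_elim
      case (elim k)
      have "z \<bullet> constr f (x k) \<le> (\<Sum>i\<in>UNIV. z $ i * d)"
        unfolding inner_vec_def using z elim
        by (intro sum_mono) (auto simp: nonneg_orthant_def constr_def less_imp_le intro!: mult_left_mono)
      also have "\<dots> = (\<Sum>i\<in>UNIV. z $ i) * d" by (simp add: sum_distrib_right)
      also have "\<dots> \<le> e" using sz e by (simp add: d_def divide_simps algebra_simps)
      finally show ?case using dual_fun_le[OF xC, of f0 f z k] by (metis order_trans add_left_mono
            ereal_less_eq(3) plus_ereal.simps(1))
    qed
    have "dual_fun C f0 f z \<le> limsup (\<lambda>k. ereal (f0 (x k)) + ereal e)"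
      using ev by (intro order_trans[OF _ Liminf_le_Limsup] Liminf_bounded) auto
    also have "\<dots> = limsup (\<lambda>k. ereal (f0 (x k))) + ereal e"
      by (rule Limsup_add_ereal_right) auto
    finally show "dual_fun C f0 f z \<le> limsup (\<lambda>k. ereal (f0 (x k))) + ereal e" .
  qed
qed

lemma asym_inf_le_primal_value: "asym_inf C f0 f \<le> primal_value C f0 f"
  unfolding primal_value_def
proof (rule INF_greatest)
  fix x assume "x \<in> feasible C f"
  then have "asym_feasible C f (\<lambda>_. x)"
    by (auto simp: asym_feasible_def feasible_def Limsup_const)
  then have "asym_inf C f0 f \<le> limsup (\<lambda>k::nat. ereal (f0 x))"
    unfolding asym_inf_def by (intro INF_lower2[where i = "\<lambda>_. x"]) auto
  then show "asym_inf C f0 f \<le> ereal (f0 x)" by (simp add: Limsup_const)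
qed

text \<open>The Lagrangian at the Slater point decreases at rate at least \<open>\<eta>\<close> in
  the sum of the multipliers. Superlevel sets of the dual are therefore bounded, and the supremum is
  attained on a compact set.\<close>

lemma slater_dual_attained:
  fixes f :: "'m::finite \<Rightarrow> real^'n \<Rightarrow> real"
  assumes sl: "slater C f" and D: "dual_value C f0 f > - \<infinity>"
  shows "\<exists>p. dual_optimal C f0 f p"
proof -
  obtain xh where xh: "xh \<in> C" "\<And>j. f j xh < 0" using sl by (auto simp: slater_def)
  define \<eta> where "\<eta> = Min (range (\<lambda>j. - f j xh))"
  have \<eta>: "0 < \<eta>" "\<And>j. \<eta> \<le> - f j xh" using xh(2) by (auto simp: \<eta>_def)
  obtain z0 a where z0: "z0 \<in> nonneg_orthant" and a: "\<And>x. x \<in> C \<Longrightarrow> a \<le> f0 x + z0 \<bullet> constr f x"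
    using dual_finite_point[OF D] by blast
  \<comment> \<open>Including \<open>norm z0\<close> puts \<open>z0\<close> into the ball, so the
    maximum over it is at least \<open>a\<close> and also dominates every multiplier with value
    below \<open>a\<close>.\<close>
  define R where "R = max (norm z0) ((f0 xh - a) / \<eta>)"
  have R: "norm z \<le> R" if z: "z \<in> nonneg_orthant" and ge: "ereal a \<le> dual_fun C f0 f z" for z
  proof -
    have "norm z \<le> (\<Sum>i\<in>UNIV. \<bar>z $ i\<bar>)" by (rule norm_le_l1_cart)
    also have "\<dots> = (\<Sum>i\<in>UNIV. z $ i)" using z by (simp add: nonneg_orthant_def)
    finally have "norm z * \<eta> \<le> (\<Sum>i\<in>UNIV. z $ i) * \<eta>" using \<eta> by (intro mult_right_mono) auto
    also have "\<dots> \<le> (\<Sum>i\<in>UNIV. z $ i * - f i xh)"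
      unfolding sum_distrib_right using z \<eta>
      by (intro sum_mono mult_left_mono) (auto simp: nonneg_orthant_def)
    also have "\<dots> = - (z \<bullet> constr f xh)" by (simp add: inner_vec_def constr_def sum_negf)
    finally have "norm z * \<eta> \<le> f0 xh - a"
      using order_trans[OF ge dual_fun_le[OF xh(1)]] by simp
    then show ?thesis using \<eta> by (simp add: R_def pos_le_divide_eq le_max_iff_disj)
  qed
  define S where "S = nonneg_orthant \<inter> cball (0 :: real^'m) R"
  have S: "compact S" unfolding S_def
    by (intro closed_Int_compact closed_nonneg_orthant compact_cball)
  have z0S: "z0 \<in> S" using z0 by (simp add: S_def R_def)
  then obtain p where p: "p \<in> S" "\<And>z. z \<in> S \<Longrightarrow> dual_fun C f0 f z \<le> dual_fun C f0 f p"
    using dual_fun_attains_sup[OF S] by blast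
  have ap: "ereal a \<le> dual_fun C f0 f p"
    using order_trans[OF dual_fun_ge[OF a] p(2)[OF z0S]] by simp
  have "dual_fun C f0 f z \<le> dual_fun C f0 f p" if z: "z \<in> nonneg_orthant" for z
  proof (cases "ereal a \<le> dual_fun C f0 f z")
    case True
    then show ?thesis using R[OF z] p(2)[of z] z by (simp add: S_def)
  next
    case False
    then show ?thesis using ap by simp
  qed
  then show ?thesis using p(1) by (auto simp: dual_optimal_def S_def)
qed

section \<open>The multiplier sequence generated by the method\<close>

lemma tendsto_scaleR_inverse_zero:
  fixes u :: "nat \<Rightarrow> 'a::real_normed_vector"
  assumes "\<delta> > 0" "\<And>k. \<delta> \<le> c k" "u \<longlonglongrightarrow> 0"
  shows "(\<lambda>k. (1 / c k) *\<^sub>R u k) \<longlonglongrightarrow> 0"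
proof (rule tendsto_norm_zero_cancel, rule tendsto_sandwich[OF _ _ tendsto_const])
  show "\<forall>\<^sub>F k in sequentially. 0 \<le> norm ((1 / c k) *\<^sub>R u k)" by simp
  have "norm ((1 / c k) *\<^sub>R u k) \<le> norm (u k) / \<delta>" for k
    using assms(1,2) less_le_trans[OF assms(1,2), of k] by (simp add: frac_le)
  then show "\<forall>\<^sub>F k in sequentially. norm ((1 / c k) *\<^sub>R u k) \<le> norm (u k) / \<delta>" by simp
  show "(\<lambda>k. norm (u k) / \<delta>) \<longlonglongrightarrow> 0"
    using tendsto_divide[OF tendsto_norm[OF assms(3)] tendsto_const, of \<delta>] assms(1) by simp
qed

text \<open>Solving the averaging step for the multiplier exhibits it as \<open>y (Suc k)\<close>
  pushed further away from the anchor. The estimates for constraints and objective thus become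
  statements about \<open>y\<close> alone.\<close>

lemma AALM_multiplier_update:
  assumes "AALM C f0 f c \<epsilon> x y"
  shows "multiplier_update f (x (Suc k)) (y k) (c k)
    = y (Suc k) + (1 / (real k + 1)) *\<^sub>R (y (Suc k) - y 0)" (is "?Y = _")
proof -
  have "y (Suc k) = (1 / (real k + 2)) *\<^sub>R y 0 + ((real k + 1) / (real k + 2)) *\<^sub>R ?Y"
    using assms by (simp add: AALM_def)
  then have "(real k + 2) *\<^sub>R y (Suc k) = y 0 + (real k + 1) *\<^sub>R ?Y"
    by (simp add: scaleR_add_right)
  then have "(real k + 1) *\<^sub>R ?Y
      = (real k + 1) *\<^sub>R (y (Suc k) + (1 / (real k + 1)) *\<^sub>R (y (Suc k) - y 0))"
    by (simp add: scaleR_add_right algebra_simps scaleR_2)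
  then show ?thesis by (subst (asm) scaleR_cancel_left) auto
qed

text \<open>Everything later arguments need about one step. The two inequalities for
  \<open>G k\<close> identify it with the dual value at \<open>J k\<close> and make
  \<open>(J k - y k) / c k\<close> a supergradient there relative to the orthant; a real
  \<open>G k\<close> avoids arithmetic with infinite values.\<close>

lemma AALM_iterates:
  fixes C :: "(real^'n) set" and f :: "'m::finite \<Rightarrow> real^'n \<Rightarrow> real"
  assumes P: "convex_program C f0 f" and D: "dual_value C f0 f > - \<infinity>" and A: "AALM C f0 f c \<epsilon> x y"
  defines "Y \<equiv> \<lambda>k. multiplier_update f (x (Suc k)) (y k) (c k)"
  obtains J G where
    "\<And>k. x (Suc k) \<in> C"
    "\<And>k. J k \<in> nonneg_orthant"
    "\<And>k. norm (Y k - J k) \<le> \<epsilon> k"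
    "\<And>k z. z \<in> C \<Longrightarrow> G k \<le> f0 z + J k \<bullet> constr f z"
    "\<And>k z. z \<in> nonneg_orthant \<Longrightarrow>
       dual_fun C f0 f z \<le> ereal (G k + (z - J k) \<bullet> (J k - y k) / c k)"
    "\<And>k. ereal (f0 (x (Suc k)) + ((norm (Y k))\<^sup>2 - (norm (y k))\<^sup>2 - (\<epsilon> k)\<^sup>2) / (2 * c k))
       \<le> dual_value C f0 f"
proof -
  have c: "c k > 0" for k using A by (auto simp: AALM_def)
  have e: "\<epsilon> k \<ge> 0" for k using A by (auto simp: AALM_def criterion_C_def)
  have crit: "aug_lagrangian C f0 f (x (Suc k)) (y k) (c k)
            - (INF z. aug_lagrangian C f0 f z (y k) (c k)) \<le> ereal ((\<epsilon> k)\<^sup>2 / (2 * c k))" for k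
    using A by (auto simp: AALM_def criterion_C_def)
  have "\<exists>J I. J \<in> nonneg_orthant \<and>
    (INF z. aug_lagrangian C f0 f z (y k) (c k)) = ereal I \<and>
    (\<forall>x\<in>C. I + (norm (J - y k))\<^sup>2 / (2 * c k) \<le> f0 x + J \<bullet> constr f x) \<and>
    (\<forall>z\<in>nonneg_orthant.
       dual_fun C f0 f z \<le> ereal (I + (norm (z - y k))\<^sup>2 / (2 * c k) - (norm (z - J))\<^sup>2 / (2 * c k)))" for k
    using aug_lagrangian_prox[OF P D c[of k], of "y k"] by metis
  then obtain J I where J: "\<And>k. J k \<in> nonneg_orthant"
    and I: "\<And>k. (INF z. aug_lagrangian C f0 f z (y k) (c k)) = ereal (I k)"
    and G: "\<And>k x. x \<in> C \<Longrightarrow> I k + (norm (J k - y k))\<^sup>2 / (2 * c k) \<le> f0 x + J k \<bullet> constr f x"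
    and sup: "\<And>k z. z \<in> nonneg_orthant \<Longrightarrow> dual_fun C f0 f z \<le>
      ereal (I k + (norm (z - y k))\<^sup>2 / (2 * c k) - (norm (z - J k))\<^sup>2 / (2 * c k))"
    by metis
  \<comment> \<open>Outside \<open>C\<close> the augmented Lagrangian is infinite while its infimum
    is real, which contradicts the criterion.\<close>
  have xC: "x (Suc k) \<in> C" for k
    using crit[of k] unfolding I by (auto simp: aug_lagrangian_def split: if_splits)
  have crit': "f0 (x (Suc k)) + ((norm (Y k))\<^sup>2 - (norm (y k))\<^sup>2) / (2 * c k) \<le> I k + (\<epsilon> k)\<^sup>2 / (2 * c k)" for k
    using crit[of k] unfolding I aug_lagrangian_eq[OF xC] Y_def by simp
  show thesis
  proof (rule that[of J "\<lambda>k. I k + (norm (J k - y k))\<^sup>2 / (2 * c k)"])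
    show "x (Suc k) \<in> C" "J k \<in> nonneg_orthant" for k by (fact xC J)+
    show "I k + (norm (J k - y k))\<^sup>2 / (2 * c k) \<le> f0 z + J k \<bullet> constr f z" if "z \<in> C" for k z
      using G[OF that] .
    show "norm (Y k - J k) \<le> \<epsilon> k" for k
    proof -
      \<comment> \<open>The proximal inequality at \<open>x (Suc k)\<close> and strong concavity at
        \<open>z = J k\<close> bound the squared distance by the gap, which criterion (C)
        limits.\<close>
      have "I k \<le> f0 (x (Suc k)) + ((norm (Y k))\<^sup>2 - (norm (y k))\<^sup>2) / (2 * c k)
          - (norm (J k - Y k))\<^sup>2 / (2 * c k)"
        using G[OF xC, of k k] lagrangian_le_aug_lagrangian[OF c[of k] J[of k], of f0 "x (Suc k)" f "y k"]
        unfolding Y_def by linarith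
      then have "(norm (J k - Y k))\<^sup>2 / (2 * c k) \<le> (\<epsilon> k)\<^sup>2 / (2 * c k)" using crit'[of k] by linarith
      then have "(norm (Y k - J k))\<^sup>2 \<le> (\<epsilon> k)\<^sup>2"
        using c[of k] by (simp add: divide_le_cancel norm_minus_commute)
      then show ?thesis using e by (rule power2_le_imp_le)
    qed
    show "dual_fun C f0 f z \<le> ereal (I k + (norm (J k - y k))\<^sup>2 / (2 * c k) + (z - J k) \<bullet> (J k - y k) / c k)"
      if "z \<in> nonneg_orthant" for k z
    proof -
      have "(norm (z - y k))\<^sup>2 - (norm (z - J k))\<^sup>2 = (norm (J k - y k))\<^sup>2 + 2 * ((z - J k) \<bullet> (J k - y k))"
        by (simp add: power2_norm_eq_inner inner_diff_left inner_diff_right inner_commute algebra_simps)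
      then have "((norm (z - y k))\<^sup>2 - (norm (z - J k))\<^sup>2) / (2 * c k)
          = ((norm (J k - y k))\<^sup>2 + 2 * ((z - J k) \<bullet> (J k - y k))) / (2 * c k)" by (rule arg_cong)
      then have "I k + (norm (z - y k))\<^sup>2 / (2 * c k) - (norm (z - J k))\<^sup>2 / (2 * c k)
          = I k + (norm (J k - y k))\<^sup>2 / (2 * c k) + (z - J k) \<bullet> (J k - y k) / c k"
        by (simp add: diff_divide_distrib add_divide_distrib)
      then show ?thesis using sup[OF that, of k] by (simp only:)
    qed
    show "ereal (f0 (x (Suc k)) + ((norm (Y k))\<^sup>2 - (norm (y k))\<^sup>2 - (\<epsilon> k)\<^sup>2) / (2 * c k))
        \<le> dual_value C f0 f" for k
    proof -
      have "0 \<le> (norm (J k - y k))\<^sup>2 / (2 * c k)" using c[of k] by simp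
      then have "I k \<le> f0 z + J k \<bullet> constr f z" if "z \<in> C" for z
        using G[OF that, of k] by linarith
      then have "ereal (I k) \<le> dual_value C f0 f"
        using order_trans[OF dual_fun_ge dual_fun_le_dual_value[OF J]] by blast
      moreover have "f0 (x (Suc k)) + ((norm (Y k))\<^sup>2 - (norm (y k))\<^sup>2 - (\<epsilon> k)\<^sup>2) / (2 * c k) \<le> I k"
        using crit'[of k] by (simp add: diff_divide_distrib)
      ultimately show ?thesis by (metis ereal_less_eq(3) order_trans)
    qed
  qed
qed

text \<open>The dual value at \<open>p\<close> is at least \<open>G k\<close>, since it dominates
  that at \<open>J k\<close>; the supergradient inequality at \<open>p\<close> then forces the sign
  condition of \<open>halpern_bounded\<close>.\<close>

lemma AALM_bounded:
  fixes C :: "(real^'n) set" and f :: "'m::finite \<Rightarrow> real^'n \<Rightarrow> real"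
  assumes P: "convex_program C f0 f" and D: "dual_value C f0 f > - \<infinity>" and A: "AALM C f0 f c \<epsilon> x y"
    and opt: "dual_optimal C f0 f p"
  shows "bounded (range y)"
proof -
  obtain J G where J: "\<And>k. J k \<in> nonneg_orthant"
    and err: "\<And>k. norm (multiplier_update f (x (Suc k)) (y k) (c k) - J k) \<le> \<epsilon> k"
    and G: "\<And>k z. z \<in> C \<Longrightarrow> G k \<le> f0 z + J k \<bullet> constr f z"
    and sup: "\<And>k z. z \<in> nonneg_orthant \<Longrightarrow>
       dual_fun C f0 f z \<le> ereal (G k + (z - J k) \<bullet> (J k - y k) / c k)"
    using AALM_iterates[OF P D A] by metis
  have "0 \<le> (p - J k) \<bullet> (J k - y k)" for k
  proof -
    have "ereal (G k) \<le> dual_fun C f0 f (J k)" by (rule dual_fun_ge[OF G])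
    also have "\<dots> \<le> dual_fun C f0 f p" using opt J by (auto simp: dual_optimal_def)
    also have "\<dots> \<le> ereal (G k + (p - J k) \<bullet> (J k - y k) / c k)"
      using opt by (intro sup) (auto simp: dual_optimal_def)
    finally have "0 \<le> (p - J k) \<bullet> (J k - y k) / c k" by simp
    moreover have "c k > 0" using A by (auto simp: AALM_def)
    ultimately show ?thesis by (simp add: zero_le_divide_iff)
  qed
  then show ?thesis
    using A by (intro halpern_bounded[OF _ err]) (auto simp: AALM_def criterion_C_def)
qed

text \<open>
  No maximizer of the dual is known to exist here, so the Halpern iteration is applied to the dual
  restricted to a ball containing all \<open>J k\<close>, which are proximal points of the restriction too; the limit
  turns out to be optimal without the restriction.
\<close>

lemma AALM_dual_convergence:
  fixes C :: "(real^'n) set" and f :: "'m::finite \<Rightarrow> real^'n \<Rightarrow> real"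
  assumes P: "convex_program C f0 f" and D: "dual_value C f0 f > - \<infinity>" and A: "AALM C f0 f c \<epsilon> x y"
    and c: "\<delta> > 0" "\<And>k. \<delta> \<le> c k" and bdd: "bounded (range y)"
  shows "\<exists>p. dual_optimal C f0 f p \<and> y \<longlonglongrightarrow> p"
proof -
  define Y where "Y k = multiplier_update f (x (Suc k)) (y k) (c k)" for k
  obtain J G where J: "\<And>k. J k \<in> nonneg_orthant"
    and err: "\<And>k. norm (Y k - J k) \<le> \<epsilon> k"
    and G: "\<And>k z. z \<in> C \<Longrightarrow> G k \<le> f0 z + J k \<bullet> constr f z"
    and sup: "\<And>k z. z \<in> nonneg_orthant \<Longrightarrow>
       dual_fun C f0 f z \<le> ereal (G k + (z - J k) \<bullet> (J k - y k) / c k)"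
    using AALM_iterates[OF P D A] unfolding Y_def by metis
  have cp: "c k > 0" for k using less_le_trans[OF c] .
  have rec: "y (Suc k) = (1 / (real k + 2)) *\<^sub>R y 0 + ((real k + 1) / (real k + 2)) *\<^sub>R Y k" for k
    using A by (simp add: AALM_def Y_def)
  have sm: "summable \<epsilon>" using A by (auto simp: AALM_def criterion_C_def)
  obtain B where B: "\<And>k. norm (y k) \<le> B" using bdd by (auto simp: bounded_iff)
  have e: "\<epsilon> k \<le> suminf \<epsilon>" for k
    using sum_le_suminf[OF sm, of "{k}"] A by (auto simp: AALM_def criterion_C_def)
  \<comment> \<open>\<open>B + 2 * B\<close> bounds the multiplier through the formula of
    \<open>AALM_multiplier_update\<close>; the last term accounts for the distance to
    \<open>J k\<close>.\<close>
  define R where "R = B + 2 * B + suminf \<epsilon>"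
  have JR: "norm (J k) \<le> R" for k
  proof -
    have "norm (y (Suc k) - y 0) \<le> 2 * B"
      using norm_triangle_ineq4[of "y (Suc k)" "y 0"] B[of 0] B[of "Suc k"] by linarith
    moreover have "norm ((1 / (real k + 1)) *\<^sub>R (y (Suc k) - y 0)) \<le> norm (y (Suc k) - y 0)"
      by (simp add: divide_le_eq mult_le_cancel_left1)
    ultimately have "norm (Y k) \<le> B + 2 * B"
      unfolding Y_def AALM_multiplier_update[OF A] using norm_triangle_ineq[of "y (Suc k)" "(1 / (real k + 1)) *\<^sub>R (y (Suc k) - y 0)"]
        B[of "Suc k"] by linarith
    moreover have "norm (J k) \<le> norm (Y k) + norm (Y k - J k)"
      using norm_triangle_ineq4[of "Y k" "Y k - J k"] by simp
    ultimately show ?thesis unfolding R_def using err[of k] e[of k] by linarith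
  qed
  define S where "S = nonneg_orthant \<inter> cball (0 :: real^'m) R"
  have JS: "J k \<in> S" for k using J JR by (simp add: S_def)
  have S: "compact S" unfolding S_def
    by (intro closed_Int_compact closed_nonneg_orthant compact_cball)
  obtain p0 where p0: "p0 \<in> S" "\<And>z. z \<in> S \<Longrightarrow> dual_fun C f0 f z \<le> dual_fun C f0 f p0"
    using dual_fun_attains_sup[OF S] JS by blast
  have G_le: "ereal (G k) \<le> dual_fun C f0 f p0" for k
    by (rule order_trans[OF dual_fun_ge[OF G] p0(2)[OF JS]])
  obtain v where v: "dual_fun C f0 f p0 = ereal v"
  proof (cases "dual_fun C f0 f p0")
    case PInf
    have "C \<noteq> {}" using P by (auto simp: convex_program_def)
    then show thesis using dual_fun_le[of _ C f0 f p0] PInf by force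
  qed (use G_le[of 0] in auto)
  \<comment> \<open>The maximizers over \<open>S\<close>, written with one halfspace for each
    \<open>x\<close>, so that closedness and convexity are immediate.\<close>
  define K where "K = (\<Inter>x\<in>C. {z \<in> S. v \<le> f0 x + z \<bullet> constr f x})"
  have p0K: "p0 \<in> K"
    using p0(1) dual_fun_le[of _ C f0 f p0] by (auto simp: K_def v)
  have KS: "K \<subseteq> S" using P by (auto simp: K_def convex_program_def)
  have Kv: "ereal v \<le> dual_fun C f0 f q" if "q \<in> K" for q
    using that by (intro dual_fun_ge) (auto simp: K_def)
  \<comment> \<open>The supergradient inequality at \<open>J k\<close> holds on the whole orthant,
    so a cluster point is compared with every \<open>z\<close>, inside the ball or not.\<close>
  have glob: "q \<in> nonneg_orthant \<and> (\<forall>z\<in>nonneg_orthant. dual_fun C f0 f z \<le> dual_fun C f0 f q)"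
    if r: "strict_mono r" and Jy: "(\<lambda>k. J (r k) - y (r k)) \<longlonglongrightarrow> 0" and Jq: "(\<lambda>k. J (r k)) \<longlonglongrightarrow> q" for r q
  proof (intro conjI ballI)
    show "q \<in> nonneg_orthant"
      by (rule closed_sequentially[OF closed_nonneg_orthant _ Jq]) (rule J)
    fix z :: "real^'m" assume z: "z \<in> nonneg_orthant"
    \<comment> \<open>The lower bound \<open>\<delta>\<close> on \<open>c\<close> makes the
      supergradients vanish along with \<open>J - y\<close>.\<close>
    have w: "(\<lambda>k. (1 / c (r k)) *\<^sub>R (J (r k) - y (r k))) \<longlonglongrightarrow> 0"
      by (rule tendsto_scaleR_inverse_zero[OF c(1) _ Jy]) (rule c(2))
    show "dual_fun C f0 f z \<le> dual_fun C f0 f q"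
      unfolding dual_fun_eq[of C f0 f q]
    proof (rule INF_greatest)
      fix x assume x: "x \<in> C"
      \<comment> \<open>Replacing \<open>G\<close> by the Lagrangian at a fixed \<open>x\<close>
        gives a bound that is continuous in the multiplier.\<close>
      let ?b = "\<lambda>k. f0 x + J (r k) \<bullet> constr f x + (z - J (r k)) \<bullet> ((1 / c (r k)) *\<^sub>R (J (r k) - y (r k)))"
      have "dual_fun C f0 f z \<le> ereal (?b k)" for k
        using G[OF x, of "r k"] by (intro order_trans[OF sup[OF z, of "r k"]]) simp
      moreover have "?b \<longlonglongrightarrow> f0 x + q \<bullet> constr f x + (z - q) \<bullet> 0"
        by (intro tendsto_intros Jq w)
      then have "(\<lambda>k. ereal (?b k)) \<longlonglongrightarrow> ereal (f0 x + q \<bullet> constr f x)" by simp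
      ultimately show "dual_fun C f0 f z \<le> ereal (f0 x + q \<bullet> constr f x)"
        using LIMSEQ_le_const by blast
    qed
  qed
  have firm: "0 \<le> (q - J k) \<bullet> (J k - y k)" if q: "q \<in> K" for k q
  proof -
    have "ereal (G k) \<le> ereal v" using G_le[of k] v by simp
    also have "\<dots> \<le> dual_fun C f0 f q" using Kv[OF q] .
    also have "\<dots> \<le> ereal (G k + (q - J k) \<bullet> (J k - y k) / c k)"
      using q KS by (intro sup) (auto simp: S_def)
    finally have "0 \<le> (q - J k) \<bullet> (J k - y k) / c k" by simp
    then show ?thesis using cp[of k] by (simp add: zero_le_divide_iff)
  qed
  have cluster: "q \<in> K"
    if r: "strict_mono r" and Jy: "(\<lambda>k. J (r k) - y (r k)) \<longlonglongrightarrow> 0" and Jq: "(\<lambda>k. J (r k)) \<longlonglongrightarrow> q" for r q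
  proof -
    have "q \<in> S" using closed_sequentially[OF compact_imp_closed[OF S] _ Jq] JS by blast
    moreover have "p0 \<in> nonneg_orthant" using p0 by (auto simp: S_def)
    then have "ereal v \<le> dual_fun C f0 f q" using glob[OF r Jy Jq] v by metis
    then have "v \<le> f0 x + q \<bullet> constr f x" if "x \<in> C" for x
      using dual_fun_le[OF that, of f0 f q] by (metis ereal_less_eq(3) order_trans)
    ultimately show ?thesis by (auto simp: K_def)
  qed
  have Kc: "closed K" "convex K"
  proof -
    have eq: "{z \<in> S. v \<le> f0 x + z \<bullet> constr f x} = S \<inter> {z. constr f x \<bullet> z \<ge> v - f0 x}" for x
      by (auto simp: inner_commute algebra_simps)
    have "convex S" unfolding S_def by (intro convex_Int convex_nonneg_orthant convex_cball)
    then show "convex K" unfolding K_def eq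
      by (intro convex_INT convex_Int convex_halfspace_ge)
    show "closed K" unfolding K_def eq
      by (intro closed_INT closed_Int ballI closed_halfspace_ge compact_imp_closed[OF S])
  qed
  define p where "p = closest_point K (y 0)"
  have Kne: "K \<noteq> {}" using p0K by auto
  have lim_y: "y \<longlonglongrightarrow> p" unfolding p_def
    by (rule halpern_convergence(1)[of y Y J \<epsilon> K]) (fact rec err sm Kc Kne firm cluster)+
  have lim_J: "J \<longlonglongrightarrow> p" unfolding p_def
    by (rule halpern_convergence(2)[of y Y J \<epsilon> K]) (fact rec err sm Kc Kne firm cluster)+
  \<comment> \<open>\<open>J\<close> and \<open>y\<close> share the limit \<open>p\<close>, so
    \<open>glob\<close> applies to the full sequence and lifts the restriction to
    \<open>S\<close>.\<close>
  have "dual_optimal C f0 f p"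
    using glob[of id p] tendsto_diff[OF lim_J lim_y] lim_J by (simp add: dual_optimal_def strict_mono_id)
  then show ?thesis using lim_y by blast
qed

section \<open>The primal sequence\<close>

text \<open>Moving an almost feasible point by a fraction \<open>t\<close> toward the Slater point
  repairs constraint violations below \<open>t * \<eta>\<close>, at an objective cost of order
  \<open>t\<close>. An asymptotic value below inf(P) would thus yield a feasible point below
  inf(P).\<close>

lemma slater_primal_le_asym_inf:
  fixes C :: "(real^'n) set" and f :: "'m::finite \<Rightarrow> real^'n \<Rightarrow> real"
  assumes P: "convex_program C f0 f" and sl: "slater C f"
  shows "primal_value C f0 f \<le> asym_inf C f0 f"
  unfolding asym_inf_def
proof (rule INF_greatest, rule ccontr)
  fix x assume "x \<in> {x. asym_feasible C f x}"
  then have xC: "\<And>k. x k \<in> C" and lim: "\<And>i. limsup (\<lambda>k. ereal (f i (x k))) \<le> 0"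
    by (auto simp: asym_feasible_def)
  assume "\<not> primal_value C f0 f \<le> limsup (\<lambda>k. ereal (f0 (x k)))"
  then have "limsup (\<lambda>k. ereal (f0 (x k))) < primal_value C f0 f" by simp
  then obtain b1 where b1: "limsup (\<lambda>k. ereal (f0 (x k))) < ereal b1" "ereal b1 < primal_value C f0 f"
    using ereal_dense2 by blast
  obtain b2 where b2: "b1 < b2" "ereal b2 < primal_value C f0 f"
    using ereal_dense2[OF b1(2)] by auto
  have cf: "convex_on UNIV f0" "\<And>j. convex_on UNIV (f j)" and Ccv: "convex C"
    using P by (auto simp: convex_program_def)
  obtain xh where xh: "xh \<in> C" "\<And>j. f j xh < 0" using sl by (auto simp: slater_def)
  define \<eta> where "\<eta> = Min (range (\<lambda>j. - f j xh))"
  have \<eta>: "0 < \<eta>" "\<And>j. \<eta> \<le> - f j xh" using xh(2) by (auto simp: \<eta>_def)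
  \<comment> \<open>The interval from \<open>b1\<close> to \<open>b2\<close> is the room reserved
    for the objective increase; the added 1 keeps the denominator positive.\<close>
  define t where "t = min 1 ((b2 - b1) / (\<bar>f0 xh - b1\<bar> + 1))"
  have t: "0 < t" "t \<le> 1" using b2(1) by (auto simp: t_def)
  have tb: "t * (f0 xh - b1) \<le> b2 - b1"
  proof -
    have "t * (f0 xh - b1) \<le> t * (\<bar>f0 xh - b1\<bar> + 1)" using t by (intro mult_left_mono) auto
    also have "\<dots> \<le> (b2 - b1) / (\<bar>f0 xh - b1\<bar> + 1) * (\<bar>f0 xh - b1\<bar> + 1)"
      by (intro mult_right_mono) (auto simp: t_def)
    also have "\<dots> = b2 - b1" by simp
    finally show ?thesis .
  qed
  have "\<forall>\<^sub>F k in sequentially. ereal (f i (x k)) < ereal (t * \<eta>)" for i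
    using lim[of i] t \<eta> by (intro Limsup_lessD) (auto intro: le_less_trans)
  then have "\<forall>\<^sub>F k in sequentially. \<forall>i. f i (x k) < t * \<eta>"
    by (simp add: eventually_all_finite)
  moreover have "\<forall>\<^sub>F k in sequentially. f0 (x k) < b1"
    using Limsup_lessD[OF b1(1)] by simp
  ultimately have "\<forall>\<^sub>F k in sequentially. (\<forall>i. f i (x k) < t * \<eta>) \<and> f0 (x k) < b1"
    by (rule eventually_conj)
  then obtain k where k: "\<And>i. f i (x k) < t * \<eta>" "f0 (x k) < b1"
    by (auto simp: eventually_sequentially)
  define w where "w = (1 - t) *\<^sub>R x k + t *\<^sub>R xh"
  have "w \<in> C" unfolding w_def using t by (intro convexD_alt[OF Ccv xC xh(1)]) auto
  moreover have "f j w \<le> 0" for j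
  proof -
    have "f j w \<le> (1 - t) * f j (x k) + t * f j xh"
      using convex_onD[OF cf(2), of t "x k" xh] t by (simp add: w_def)
    also have "\<dots> \<le> (1 - t) * (t * \<eta>) + t * (- \<eta>)"
      using t k(1)[of j] \<eta>(2)[of j] by (intro add_mono mult_left_mono) auto
    also have "\<dots> = - (t * t * \<eta>)" by (simp add: algebra_simps)
    also have "\<dots> \<le> 0" using t \<eta> by simp
    finally show ?thesis .
  qed
  ultimately have "primal_value C f0 f \<le> ereal (f0 w)"
    unfolding primal_value_def by (intro INF_lower) (simp add: feasible_def)
  moreover have "f0 w \<le> b2"
  proof -
    have "f0 w \<le> (1 - t) * f0 (x k) + t * f0 xh"
      using convex_onD[OF cf(1), of t "x k" xh] t by (simp add: w_def)
    also have "\<dots> \<le> (1 - t) * b1 + t * f0 xh"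
      using t k(2) by (intro add_mono mult_left_mono) auto
    also have "\<dots> = b1 + t * (f0 xh - b1)" by (simp add: algebra_simps)
    also have "\<dots> \<le> b2" using tb by simp
    finally show ?thesis .
  qed
  ultimately show False using b2(2) by (metis ereal_less_eq(3) leD order_trans)
qed

text \<open>
  An unbounded sequence of points \<open>X k\<close> would pull the point at distance \<open>R\<close> from \<open>z0\<close> on the segment
  to \<open>X k\<close> into the sublevel set in the limit, since \<open>X k\<close> gets weight \<open>R / |X k - z0| \<rightarrow> 0\<close>.
\<close>

lemma sublevel_bounded_imp_bounded:
  fixes C :: "(real^'n) set" and f :: "'m::finite \<Rightarrow> real^'n \<Rightarrow> real"
  assumes P: "convex_program C f0 f"
    and L: "{z \<in> feasible C f. f0 z \<le> \<alpha>} \<noteq> {}" "bounded {z \<in> feasible C f. f0 z \<le> \<alpha>}"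
    and X: "\<And>k. X k \<in> C" "\<And>k. f0 (X k) \<le> \<beta>0" "\<And>j k. f j (X k) \<le> \<beta> j"
  shows "bounded (range (X :: nat \<Rightarrow> real^'n))"
proof (rule ccontr)
  assume unb: "\<not> bounded (range X)"
  have cf: "convex_on UNIV f0" "\<And>j. convex_on UNIV (f j)" and C: "convex C" "closed C"
    using P by (auto simp: convex_program_def)
  obtain z0 where z0: "z0 \<in> C" "\<And>j. f j z0 \<le> 0" "f0 z0 \<le> \<alpha>"
    using L(1) by (auto simp: feasible_def)
  obtain M where M: "\<And>z. z \<in> C \<Longrightarrow> \<forall>j. f j z \<le> 0 \<Longrightarrow> f0 z \<le> \<alpha> \<Longrightarrow> norm z \<le> M"
    using L(2) by (auto simp: bounded_iff feasible_def)
  \<comment> \<open>A point at distance \<open>R\<close> from \<open>z0\<close> has norm at least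
    \<open>M + 1\<close>, hence lies outside the bounded sublevel set.\<close>
  define R where "R = M + norm z0 + 1"
  have "0 \<le> M" using order_trans[OF norm_ge_zero M[of z0]] z0 by simp
  then have R: "R > 0" unfolding R_def using norm_ge_zero[of z0] by linarith
  have "\<exists>k. R * (real n + 1) \<le> norm (X k - z0)" for n
  proof (rule ccontr)
    assume "\<not> ?thesis"
    then have "norm (X k) \<le> norm z0 + R * (real n + 1)" for k
      using norm_triangle_ineq2[of "X k" z0] by (smt (verit))
    then show False using unb by (auto simp: bounded_iff)
  qed
  then obtain s where s: "\<And>n. R * (real n + 1) \<le> norm (X (s n) - z0)" by metis
  define t where "t n = R / norm (X (s n) - z0)" for n
  have pos: "0 < norm (X (s n) - z0)" for n
    using R by (intro less_le_trans[OF _ s[of n]]) auto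
  have t: "0 \<le> t n" "t n \<le> 1 / (real n + 1)" for n
    using R s[of n] pos[of n] by (auto simp: t_def field_simps)
  have t1: "t n \<le> 1" for n using t(2)[of n] by (rule order_trans) simp
  have t0: "t \<longlonglongrightarrow> 0"
  proof (rule tendsto_sandwich[OF _ _ tendsto_const])
    show "(\<lambda>n. 1 / (real n + 1)) \<longlonglongrightarrow> 0"
      using LIMSEQ_inverse_real_of_nat by (simp add: inverse_eq_divide add.commute)
  qed (use t in auto)
  define w where "w n = (1 - t n) *\<^sub>R z0 + t n *\<^sub>R X (s n)" for n
  have wC: "w n \<in> C" for n
    unfolding w_def using t t1 by (intro convexD_alt[OF C(1) z0(1) X(1)]) auto
  have wR: "norm (w n - z0) = R" for n
  proof -
    have "w n - z0 = t n *\<^sub>R (X (s n) - z0)" by (simp add: w_def algebra_simps)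
    then show ?thesis using pos[of n] R by (simp add: t_def)
  qed
  have "bounded (range w)"
  proof (rule boundedI)
    fix v assume "v \<in> range w"
    then show "norm v \<le> norm z0 + R"
      using wR norm_triangle_ineq2[of v z0] by fastforce
  qed
  then obtain q r where r: "strict_mono (r :: nat \<Rightarrow> nat)" and q: "(\<lambda>n. w (r n)) \<longlonglongrightarrow> q"
    using bounded_imp_convergent_subsequence[of w] by (auto simp: o_def)
  have tr: "(\<lambda>n. t (r n)) \<longlonglongrightarrow> 0" using LIMSEQ_subseq_LIMSEQ[OF t0 r] by (simp add: o_def)
  have lim: "h q \<le> h z0" if h: "convex_on UNIV h" and b: "\<And>k. h (X k) \<le> b" for h b
  proof (rule LIMSEQ_le)
    have "isCont h q"
      using convex_on_continuous[OF open_UNIV h] continuous_on_eq_continuous_at by blast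
    then show "(\<lambda>n. h (w (r n))) \<longlonglongrightarrow> h q" using q by (rule isCont_tendsto_compose)
    have "(\<lambda>n. (1 - t (r n)) * h z0 + t (r n) * b) \<longlonglongrightarrow> (1 - 0) * h z0 + 0 * b"
      by (intro tendsto_intros tr)
    then show "(\<lambda>n. (1 - t (r n)) * h z0 + t (r n) * b) \<longlonglongrightarrow> h z0" by simp
    have "h (w n) \<le> (1 - t n) * h z0 + t n * b" for n
    proof -
      have "h (w n) \<le> (1 - t n) * h z0 + t n * h (X (s n))"
        using convex_onD[OF h, of "t n" z0 "X (s n)"] t t1 by (simp add: w_def)
      also have "\<dots> \<le> (1 - t n) * h z0 + t n * b"
        using t(1) b by (intro add_mono mult_left_mono order_refl) auto
      finally show ?thesis .
    qed
    then show "\<exists>N. \<forall>n\<ge>N. h (w (r n)) \<le> (1 - t (r n)) * h z0 + t (r n) * b" by blast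
  qed
  have "norm q \<le> M"
  proof (rule M)
    show "q \<in> C" using closed_sequentially[OF C(2) wC q] .
    show "\<forall>j. f j q \<le> 0" using lim[OF cf(2) X(3)] z0(2) order_trans by blast
    show "f0 q \<le> \<alpha>" using lim[OF cf(1) X(2)] z0(3) by (rule order_trans)
  qed
  moreover have "norm (q - z0) = R"
    using LIMSEQ_unique[OF tendsto_norm[OF tendsto_diff[OF q tendsto_const]], of z0 R] wR by simp
  ultimately show False
    using norm_triangle_ineq4[of q z0] by (simp add: R_def)
qed

text \<open>With \<open>n = k + 1\<close> the expansion adds 2/n times the inner product of
  \<open>a - b\<close> with \<open>a\<close> and 1/n^2 times the square of \<open>a - b\<close>.
  Collecting both into one product gives (2n + 1)/n^2, and 2n + 1 = 2k + 3.\<close>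

lemma norm_over_relaxed_sq:
  fixes a b :: "'a::real_inner"
  shows "(norm (a + (1 / (real k + 1)) *\<^sub>R (a - b)))\<^sup>2 = (norm a)\<^sup>2 +
    (2 * real k + 3) / (real k + 1)\<^sup>2 * ((a - b) \<bullet> (a - (1 / (2 * real k + 3)) *\<^sub>R b))"
proof -
  define n where "n = real k + 1"
  have n: "n > 0" "2 * real k + 3 = 2 * n + 1" by (auto simp: n_def)
  have "(2 * n + 1) *\<^sub>R (a - (1 / (2 * n + 1)) *\<^sub>R b) = (2 * n) *\<^sub>R a + (a - b)"
    using n by (simp add: scaleR_diff_right scaleR_add_left)
  then have "(2 * n + 1) * ((a - b) \<bullet> (a - (1 / (2 * n + 1)) *\<^sub>R b))
      = (a - b) \<bullet> ((2 * n) *\<^sub>R a + (a - b))" by (metis inner_scaleR_right)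
  also have "\<dots> = 2 * n * ((a - b) \<bullet> a) + (a - b) \<bullet> (a - b)" by (simp add: inner_add_right)
  finally have eq: "(2 * n + 1) / n\<^sup>2 * ((a - b) \<bullet> (a - (1 / (2 * n + 1)) *\<^sub>R b))
      = (2 * n * ((a - b) \<bullet> a) + (a - b) \<bullet> (a - b)) / n\<^sup>2" by simp
  have "(norm (a + (1 / n) *\<^sub>R (a - b)))\<^sup>2 = a \<bullet> a + 2 * (1 / n) * ((a - b) \<bullet> a) + (1 / n)\<^sup>2 * ((a - b) \<bullet> (a - b))"
    unfolding power2_norm_eq_inner
    by (simp only: inner_add_left inner_add_right inner_scaleR_left inner_scaleR_right inner_commute
        power2_eq_square)
  also have "\<dots> = (norm a)\<^sup>2 + (2 * n * ((a - b) \<bullet> a) + (a - b) \<bullet> (a - b)) / n\<^sup>2"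
    unfolding power2_norm_eq_inner using n by (simp add: add_divide_distrib power2_eq_square)
  finally show ?thesis unfolding n(2) eq n_def[symmetric] .
qed

section \<open>Constraint and objective estimates along the iterates, and their limits\<close>

lemma AALM_constraint_bound:
  assumes A: "AALM C f0 f c \<epsilon> x y"
  shows "f i (x (Suc k)) \<le>
    1 / c k * (y (Suc k) $ i - y k $ i + 1 / (real k + 1) * (y (Suc k) $ i - y 0 $ i))"
proof -
  have c: "c k > 0" using A by (simp add: AALM_def)
  have "y k $ i + c k * f i (x (Suc k)) \<le> multiplier_update f (x (Suc k)) (y k) (c k) $ i"
    by (simp add: multiplier_update_nth)
  also have "\<dots> = y (Suc k) $ i + 1 / (real k + 1) * (y (Suc k) $ i - y 0 $ i)"
    unfolding AALM_multiplier_update[OF A] by simp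
  finally have "c k * f i (x (Suc k))
      \<le> y (Suc k) $ i - y k $ i + 1 / (real k + 1) * (y (Suc k) $ i - y 0 $ i)" by linarith
  then show ?thesis using c by (simp add: pos_le_divide_eq mult.commute)
qed

lemma AALM_multiplier_tendsto:
  assumes A: "AALM C f0 f c \<epsilon> x y" and y: "y \<longlonglongrightarrow> p"
  shows "(\<lambda>k. multiplier_update f (x (Suc k)) (y k) (c k)) \<longlonglongrightarrow> p"
proof -
  have "(\<lambda>k. 1 / (real k + 1)) \<longlonglongrightarrow> 0"
    using LIMSEQ_inverse_real_of_nat by (simp add: inverse_eq_divide add.commute)
  then have "(\<lambda>k. y (Suc k) + (1 / (real k + 1)) *\<^sub>R (y (Suc k) - y 0)) \<longlonglongrightarrow> p + 0 *\<^sub>R (p - y 0)"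
    by (intro tendsto_intros LIMSEQ_Suc[OF y])
  then show ?thesis unfolding AALM_multiplier_update[OF A] by simp
qed

lemma AALM_constraint_bound_tendsto:
  assumes A: "AALM C f0 f c \<epsilon> x y" and y: "y \<longlonglongrightarrow> p" and c: "\<delta> > 0" "\<And>k. \<delta> \<le> c k"
  shows "(\<lambda>k. 1 / c k * (y (Suc k) $ i - y k $ i
    + 1 / (real k + 1) * (y (Suc k) $ i - y 0 $ i))) \<longlonglongrightarrow> 0"
proof -
  \<comment> \<open>The bracket in the bound is the multiplier minus \<open>y k\<close>, and both
    tend to \<open>p\<close>.\<close>
  have "(\<lambda>k. multiplier_update f (x (Suc k)) (y k) (c k) $ i - y k $ i) \<longlonglongrightarrow> p $ i - p $ i"
    by (intro tendsto_intros AALM_multiplier_tendsto[OF A] y)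
  then have "(\<lambda>k. y (Suc k) $ i - y k $ i + 1 / (real k + 1) * (y (Suc k) $ i - y 0 $ i)) \<longlonglongrightarrow> 0"
    unfolding AALM_multiplier_update[OF A] by (simp add: algebra_simps)
  from tendsto_scaleR_inverse_zero[where c = c, OF c this] show ?thesis by simp
qed

text \<open>Stated against the dual value \<open>d\<close>, because the equality of \<open>d\<close>
  with the asymptotic infimum is itself deduced from this estimate.\<close>

lemma AALM_objective_bound:
  fixes C :: "(real^'n) set" and f :: "'m::finite \<Rightarrow> real^'n \<Rightarrow> real"
  assumes P: "convex_program C f0 f" and D: "dual_value C f0 f = ereal d" and A: "AALM C f0 f c \<epsilon> x y"
  shows "f0 (x (Suc k)) - d \<le> 1 / (2 * c k) * ((\<epsilon> k)\<^sup>2 + (norm (y k))\<^sup>2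
    - (norm (multiplier_update f (x (Suc k)) (y k) (c k)))\<^sup>2)"
proof -
  let ?Y = "multiplier_update f (x (Suc k)) (y k) (c k)"
  have "ereal (f0 (x (Suc k)) + ((norm ?Y)\<^sup>2 - (norm (y k))\<^sup>2 - (\<epsilon> k)\<^sup>2) / (2 * c k)) \<le> ereal d"
    using AALM_iterates[OF P _ A] D by (metis less_ereal.simps(5))
  then show ?thesis by (simp add: diff_divide_distrib add_divide_distrib)
qed

text \<open>A cycle of inequalities collapses: the objective estimate puts the limsup of
  \<open>f0\<close> below \<open>d\<close>, weak duality puts \<open>d\<close> below
  \<open>asym_inf\<close>, and asymptotic feasibility of the iterates puts \<open>asym_inf\<close>
  below that limsup.\<close>

proposition AALM_convergence:
  fixes C :: "(real^'n) set" and f :: "'m::finite \<Rightarrow> real^'n \<Rightarrow> real"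
  assumes P: "convex_program C f0 f" and D: "dual_value C f0 f > - \<infinity>" and A: "AALM C f0 f c \<epsilon> x y"
    and c: "\<delta> > 0" "\<And>k. \<delta> \<le> c k" and bdd: "bounded (range y)"
  obtains p d where "dual_optimal C f0 f p" "y \<longlonglongrightarrow> p"
    "dual_value C f0 f = ereal d" "asym_inf C f0 f = ereal d"
    "asym_minimizing C f0 f (\<lambda>k. x (Suc k))"
    "(\<lambda>k. 1 / (2 * c k) * ((\<epsilon> k)\<^sup>2 + (norm (y k))\<^sup>2
      - (norm (multiplier_update f (x (Suc k)) (y k) (c k)))\<^sup>2)) \<longlonglongrightarrow> 0"
proof -
  define Y where "Y k = multiplier_update f (x (Suc k)) (y k) (c k)" for k
  define E where "E k = 1 / (2 * c k) * ((\<epsilon> k)\<^sup>2 + (norm (y k))\<^sup>2 - (norm (Y k))\<^sup>2)" for k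
  obtain p where p: "dual_optimal C f0 f p" and y: "y \<longlonglongrightarrow> p"
    using AALM_dual_convergence[OF P D A c bdd] by blast
  have "C \<noteq> {}" using P by (auto simp: convex_program_def)
  then obtain x0 where "x0 \<in> C" by blast
  then have "dual_fun C f0 f p \<le> ereal (f0 x0 + p \<bullet> constr f x0)" by (rule dual_fun_le)
  then obtain d where d: "dual_value C f0 f = ereal d"
    using D unfolding dual_optimal_value[OF p] by (cases "dual_fun C f0 f p") auto
  have E: "f0 (x (Suc k)) \<le> d + E k" for k
    using AALM_objective_bound[OF P d A, of k] by (simp add: E_def Y_def)
  have "summable \<epsilon>" using A by (auto simp: AALM_def criterion_C_def)
  then have "\<epsilon> \<longlonglongrightarrow> 0" by (rule summable_LIMSEQ_zero)
  moreover have "Y \<longlonglongrightarrow> p" using AALM_multiplier_tendsto[OF A y] by (simp add: Y_def[abs_def])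
  ultimately have "(\<lambda>k. (1/2) * ((\<epsilon> k)\<^sup>2 + (norm (y k))\<^sup>2 - (norm (Y k))\<^sup>2)) \<longlonglongrightarrow> (1/2) * (0\<^sup>2 + (norm p)\<^sup>2 - (norm p)\<^sup>2)"
    by (intro tendsto_intros y)
  then have "(\<lambda>k. (1/2) * ((\<epsilon> k)\<^sup>2 + (norm (y k))\<^sup>2 - (norm (Y k))\<^sup>2)) \<longlonglongrightarrow> 0" by simp
  from tendsto_scaleR_inverse_zero[where c = c, OF c this] have E0: "E \<longlonglongrightarrow> 0"
    by (simp add: E_def[abs_def] mult.commute)
  have xC: "x (Suc k) \<in> C" for k using AALM_iterates[OF P D A] by metis
  have af: "asym_feasible C f (\<lambda>k. x (Suc k))"
    unfolding asym_feasible_def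
  proof (intro conjI allI)
    fix i
    let ?b = "\<lambda>k. 1 / c k * (y (Suc k) $ i - y k $ i + 1 / (real k + 1) * (y (Suc k) $ i - y 0 $ i))"
    have "limsup (\<lambda>k. ereal (f i (x (Suc k)))) \<le> limsup (\<lambda>k. ereal (?b k))"
      using AALM_constraint_bound[OF A] by (intro Limsup_mono always_eventually) simp
    also have "\<dots> = ereal 0"
      using AALM_constraint_bound_tendsto[OF A y c, of i]
      by (intro lim_imp_Limsup) simp_all
    finally show "limsup (\<lambda>k. ereal (f i (x (Suc k)))) \<le> 0" unfolding zero_ereal_def .
  qed (rule xC)
  have "limsup (\<lambda>k. ereal (f0 (x (Suc k)))) \<le> limsup (\<lambda>k. ereal (d + E k))"
    using E by (intro Limsup_mono always_eventually) simp
  also have "\<dots> = ereal d"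
    using tendsto_add[OF tendsto_const E0, of d] by (intro lim_imp_Limsup) simp_all
  finally have up: "limsup (\<lambda>k. ereal (f0 (x (Suc k)))) \<le> ereal d" .
  have lo: "asym_inf C f0 f \<le> limsup (\<lambda>k. ereal (f0 (x (Suc k))))"
    unfolding asym_inf_def using af by (intro INF_lower2[where i = "\<lambda>k. x (Suc k)"]) auto
  have wd: "ereal d \<le> asym_inf C f0 f" using weak_duality_asym[of C f0 f] d by simp
  show thesis
  proof (rule that[OF p y d])
    show "asym_inf C f0 f = ereal d" using up lo wd by simp
    show "asym_minimizing C f0 f (\<lambda>k. x (Suc k))"
      using af up lo wd by (simp add: asym_minimizing_def)
    show "(\<lambda>k. 1 / (2 * c k) * ((\<epsilon> k)\<^sup>2 + (norm (y k))\<^sup>2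
        - (norm (multiplier_update f (x (Suc k)) (y k) (c k)))\<^sup>2)) \<longlonglongrightarrow> 0"
      using E0 by (simp add: E_def[abs_def] Y_def)
  qed
qed

text \<open>The right-hand sides of both estimates converge, hence are bounded, so the iterates lie
  in one common sublevel region, which \<open>sublevel_bounded_imp_bounded\<close> confines.\<close>

lemma AALM_primal_convergence:
  fixes C :: "(real^'n) set" and f :: "'m::finite \<Rightarrow> real^'n \<Rightarrow> real"
  assumes P: "convex_program C f0 f" and D: "dual_value C f0 f > - \<infinity>" and A: "AALM C f0 f c \<epsilon> x y"
    and c: "\<delta> > 0" "\<And>k. \<delta> \<le> c k" and bdd: "bounded (range y)"
    and L: "{z \<in> feasible C f. f0 z \<le> \<alpha>} \<noteq> {}" "bounded {z \<in> feasible C f. f0 z \<le> \<alpha>}"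
  shows "bounded (range (\<lambda>k. x (Suc k)))"
    and "\<And>z r. strict_mono r \<Longrightarrow> (\<lambda>k. x (Suc (r k))) \<longlonglongrightarrow> z \<Longrightarrow> primal_optimal C f0 f z"
proof -
  define E where "E k = 1 / (2 * c k) * ((\<epsilon> k)\<^sup>2 + (norm (y k))\<^sup>2
      - (norm (multiplier_update f (x (Suc k)) (y k) (c k)))\<^sup>2)" for k
  define b where "b i k = 1 / c k * (y (Suc k) $ i - y k $ i
      + 1 / (real k + 1) * (y (Suc k) $ i - y 0 $ i))" for i k
  obtain p d where y: "y \<longlonglongrightarrow> p" and d: "dual_value C f0 f = ereal d" "asym_inf C f0 f = ereal d"
    and E0: "E \<longlonglongrightarrow> 0"
    using AALM_convergence[OF P D A c bdd] unfolding E_def[abs_def] by blast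
  have E: "f0 (x (Suc k)) \<le> d + E k" for k
    using AALM_objective_bound[OF P d(1) A, of k] by (simp add: E_def)
  have b: "f i (x (Suc k)) \<le> b i k" for i k
    unfolding b_def by (rule AALM_constraint_bound[OF A])
  have b0: "b i \<longlonglongrightarrow> 0" for i
    unfolding b_def[abs_def] by (rule AALM_constraint_bound_tendsto[OF A y c])
  have xC: "x (Suc k) \<in> C" for k using AALM_iterates[OF P D A] by metis
  have bd: "\<exists>B. \<forall>k. u k \<le> B" if "u \<longlonglongrightarrow> (0::real)" for u
    using convergent_imp_bounded[OF that] by (auto simp: bounded_iff abs_le_iff)
  obtain \<beta>0 where \<beta>0: "\<And>k. E k \<le> \<beta>0" using bd[OF E0] by blast
  obtain \<beta> where \<beta>: "\<And>i k. b i k \<le> \<beta> i" using bd[OF b0] by metis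
  show "bounded (range (\<lambda>k. x (Suc k)))"
  proof (rule sublevel_bounded_imp_bounded[OF P L xC])
    show "f0 (x (Suc k)) \<le> d + \<beta>0" for k using E[of k] \<beta>0[of k] by linarith
    show "f j (x (Suc k)) \<le> \<beta> j" for j k using b \<beta> by (rule order_trans)
  qed
  fix z r assume r: "strict_mono r" and z: "(\<lambda>k. x (Suc (r k))) \<longlonglongrightarrow> z"
  have C: "closed C" and cf: "convex_on UNIV f0" "\<And>j. convex_on UNIV (f j)"
    using P by (auto simp: convex_program_def)
  have zC: "z \<in> C" using closed_sequentially[OF C _ z] xC by blast
  have lim: "h z \<le> B" if h: "convex_on UNIV h" and le: "\<And>k. h (x (Suc k)) \<le> B + e k" and e: "e \<longlonglongrightarrow> 0" for h B e
  proof (rule LIMSEQ_le)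
    have "isCont h z"
      using convex_on_continuous[OF open_UNIV h] continuous_on_eq_continuous_at by blast
    then show "(\<lambda>n. h (x (Suc (r n)))) \<longlonglongrightarrow> h z" using z by (rule isCont_tendsto_compose)
    show "(\<lambda>n. B + e (r n)) \<longlonglongrightarrow> B"
      using tendsto_add[OF tendsto_const LIMSEQ_subseq_LIMSEQ[OF e r], of B] by (simp add: o_def)
  qed (use le in blast)
  have "f i z \<le> 0" for i using lim[OF cf(2)[of i] _ b0[of i], of 0] b by simp
  then have "z \<in> feasible C f" using zC by (simp add: feasible_def)
  moreover have "f0 z \<le> f0 w" if w: "w \<in> feasible C f" for w
  proof -
    \<comment> \<open>No feasible value is below \<open>d\<close>, while the cluster point is
      feasible with objective at most \<open>d\<close>.\<close>
    have "ereal d \<le> primal_value C f0 f" using asym_inf_le_primal_value[of C f0 f] d by simp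
    also have "\<dots> \<le> ereal (f0 w)" unfolding primal_value_def using w by (rule INF_lower)
    finally show ?thesis using lim[OF cf(1) E E0] by simp
  qed
  ultimately show "primal_optimal C f0 f z" by (simp add: primal_optimal_def)
qed

theorem theorem4p1:
  fixes C :: "(real^'n) set"
    and f0 :: "real^'n \<Rightarrow> real"
    and f :: "'m::finite \<Rightarrow> real^'n \<Rightarrow> real"
    and c \<epsilon> :: "nat \<Rightarrow> real"
    and x :: "nat \<Rightarrow> real^'n"
    and y :: "nat \<Rightarrow> real^'m"
  assumes "convex_program C f0 f"
    and "dual_value C f0 f > - \<infinity>"
    and "AALM C f0 f c \<epsilon> x y"
    and c_away_from_zero: "\<exists>\<delta>>0. \<forall>k. \<delta> \<le> c k"
  shows
    "(bounded (range y) \<longrightarrow>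
        (\<exists>yinf. dual_optimal C f0 f yinf \<and> y \<longlonglongrightarrow> yinf) \<and>
        asym_minimizing C f0 f (\<lambda>k. x (Suc k)) \<and>
        (\<forall>i. (\<forall>k. f i (x (Suc k)) \<le>
                 1 / c k * (y (Suc k) $ i - y k $ i
                            + 1 / (real k + 1) * (y (Suc k) $ i - y 0 $ i))) \<and>
             (\<lambda>k. 1 / c k * (y (Suc k) $ i - y k $ i
                             + 1 / (real k + 1) * (y (Suc k) $ i - y 0 $ i)))
               \<longlonglongrightarrow> 0) \<and>
        \<bar>asym_inf C f0 f\<bar> \<noteq> \<infinity> \<and>
        (\<forall>k. ereal (f0 (x (Suc k))) - asym_inf C f0 f \<le>
             ereal (1 / (2 * c k) *
               ((\<epsilon> k)\<^sup>2 + (norm (y k))\<^sup>2 - (norm (y (Suc k)))\<^sup>2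
                - (2 * real k + 3) / (real k + 1)\<^sup>2 *
                  ((y (Suc k) - y 0) \<bullet> (y (Suc k) - (1 / (2 * real k + 3)) *\<^sub>R y 0))))))
     \<and>
     (bounded (range y) \<longleftrightarrow> (\<exists>ymax. dual_optimal C f0 f ymax))
     \<and>
     (slater C f \<longrightarrow>
        bounded (range y) \<and>
        (\<exists>ymax. dual_optimal C f0 f ymax) \<and>
        dual_value C f0 f = primal_value C f0 f \<and>
        primal_value C f0 f = asym_inf C f0 f)
     \<and>
     (bounded (range y) \<and>
      (\<exists>\<alpha>0. {z \<in> feasible C f. f0 z \<le> \<alpha>0} \<noteq> {} \<and> bounded {z \<in> feasible C f. f0 z \<le> \<alpha>0}) \<longrightarrow>
        bounded (range (\<lambda>k. x (Suc k))) \<and>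
        (\<forall>z r. strict_mono (r :: nat \<Rightarrow> nat) \<and> (\<lambda>k. x (Suc (r k))) \<longlonglongrightarrow> z
           \<longrightarrow> primal_optimal C f0 f z))"
proof -
  note P = assms(1) and D = assms(2) and A = assms(3)
  obtain \<delta> where c: "\<delta> > 0" "\<And>k. \<delta> \<le> c k" using c_away_from_zero by blast
  \<comment> \<open>Established before the goals are split, because the Slater claims reduce
    boundedness to dual attainment.\<close>
  have opt: "bounded (range y) \<longleftrightarrow> (\<exists>ymax. dual_optimal C f0 f ymax)"
    using AALM_bounded[OF P D A] AALM_dual_convergence[OF P D A c] by blast
  show ?thesis
  proof (intro conjI impI opt, goal_cases)
    case 1
    then show ?case using AALM_dual_convergence[OF P D A c] by blast
  next
    case 2
    then show ?case using AALM_convergence[OF P D A c] by blast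
  next
    case 3
    then obtain p where "y \<longlonglongrightarrow> p" using AALM_dual_convergence[OF P D A c] by blast
    then show ?case using AALM_constraint_bound[OF A] AALM_constraint_bound_tendsto[OF A _ c] by blast
  next
    case 4
    obtain d where "asym_inf C f0 f = ereal d" using AALM_convergence[OF P D A c 4] by blast
    then show ?case by simp
  next
    case 5
    \<comment> \<open>Dual value and asymptotic infimum share the real value \<open>d\<close>, so
      the bound against the dual value becomes the claim once the squared norm of the multiplier is
      expanded.\<close>
    obtain d where d: "dual_value C f0 f = ereal d" "asym_inf C f0 f = ereal d"
      using AALM_convergence[OF P D A c 5] by blast
    show ?case
    proof
      fix k
      show "ereal (f0 (x (Suc k))) - asym_inf C f0 f \<le>
             ereal (1 / (2 * c k) *
               ((\<epsilon> k)\<^sup>2 + (norm (y k))\<^sup>2 - (norm (y (Suc k)))\<^sup>2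
                - (2 * real k + 3) / (real k + 1)\<^sup>2 *
                  ((y (Suc k) - y 0) \<bullet> (y (Suc k) - (1 / (2 * real k + 3)) *\<^sub>R y 0))))"
        using AALM_objective_bound[OF P d(1) A, of k]
        unfolding d(2) AALM_multiplier_update[OF A] norm_over_relaxed_sq
        by (simp only: ereal_minus(1) ereal_less_eq(3) diff_diff_eq)
    qed
  next
    case 6
    then show ?case using opt slater_dual_attained[OF _ D] by blast
  next
    case 7
    then show ?case by (rule slater_dual_attained[OF _ D])
  next
    case 8
    then have "bounded (range y)" using opt slater_dual_attained[OF _ D] by blast
    then obtain d where "dual_value C f0 f = ereal d" "asym_inf C f0 f = ereal d"
      using AALM_convergence[OF P D A c] by blast
    then show ?case
      using slater_primal_le_asym_inf[OF P 8] asym_inf_le_primal_value[of C f0 f] by simp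
  next
    case 9
    then show ?case
      by (intro antisym slater_primal_le_asym_inf[OF P] asym_inf_le_primal_value)
  next
    case 10
    then show ?case using AALM_primal_convergence(1)[OF P D A c] by blast
  next
    case 11
    then show ?case using AALM_primal_convergence(2)[OF P D A c] by blast
  qed
qed

end
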